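(* If $T:=[T_1,\ldots,T_n]\in[B(\mathcal{H})^n]_1$ and $p\ge1$, then the mapping $$\Psi_T:H^p(B(\mathcal{X})^n_1)\to B(\mathcal{H})\quad\text{defined by}\quad\Psi_T(f):=f(T_1,\ldots,T_n)$$ is continuous, where $f(T_1,\ldots,T_n)$ is defined by the free analytic functional calculus and $B(\mathcal{H})$ is considered with the operator norm topology. Moreover, $$\|f(T_1,\ldots,T_n)\|\le\frac1{(1-\|[T_1,\ldots,T_n]\|)^{1/p}}\|f\|_p$$ for any $f\in H^p(B(\mathcal{X})^n_1)$.
   Context: $\mathcal{H}$ is a Hilbert space; $\|[T_1,\ldots,T_n]\|:=\|\sum_iT_iT_i^*\|^{1/2}$ and $[B(\mathcal{H})^n]_1$ is the set of $n$-tuples in $B(\mathcal{H})^n$ with $\|[T_1,\ldots,T_n]\|<1$. $\mathbb{F}_n^+$ is the unital free semigroup on generators $g_1,\ldots,g_n$ with identity $g_0$; $|\alpha|$ is word length; $T_\alpha:=T_{i_1}\cdots T_{i_k}$ if $\alpha=g_{i_1}\cdots g_{i_k}$, $T_{g_0}:=I$. $Hol(B(\mathcal{X})^n_1)$ is the set of formal power series $f=\sum_\alpha a_\alpha Z_\alpha$, $a_\alpha\in\mathbb{C}$, in noncommuting indeterminates with $\limsup_{k\to\infty}(\sum_{|\alpha|=k}|a_\alpha|^2)^{1/2k}\le1$. For $T\in[B(\mathcal{H})^n]_1$, the free analytic functional calculus is $f(T_1,\ldots,T_n):=\sum_{k=0}^\infty\sum_{|\alpha|=k}a_\alpha T_\alpha$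 (norm convergent). $S_1,\ldots,S_n$ are the left creation operators $S_i\xi:=e_i\otimes\xi$ on the full Fock space $F^2(H_n)=\mathbb{C}1\oplus\bigoplus_{m\ge1}H_n^{\otimes m}$, $H_n$ an $n$-dimensional Hilbert space with orthonormal basis $e_1,\ldots,e_n$. For $p\ge1$, $H^p(B(\mathcal{X})^n_1)$ is the set of $f\in Hol(B(\mathcal{X})^n_1)$ such that $r\mapsto\|f(rS_1,\ldots,rS_n)\|$ is in $L^p[0,1]$, normed by $\|f\|_p:=\big(\int_0^1\|f(rS_1,\ldots,rS_n)\|^p\,dr\big)^{1/p}$. *)

theory Defs
  imports "HOL-Analysis.Analysis"
begin

section \<open>Complex Hilbert spaces and their operators\<close>

text \<open>
  A complex Hilbert space is a complete real inner product space with a compatible complex scalar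
  multiplication and a complex inner product (linear in the first argument) whose real part is the
  real inner product. The norm, metric and topology are thus those of the library class
  \<^class>\<open>real_inner\<close>, and \<^term>\<open>(norm x)\<^sup>2\<close> equals the complex inner product of \<^term>\<open>x\<close> with itself
  (lemma \<open>cinner_self\<close> below).
\<close>

class chilbert_space = real_inner + complete_space +
  fixes scaleC :: "complex \<Rightarrow> 'a \<Rightarrow> 'a" (infixr "*\<^sub>C" 75)
    and cinner :: "'a \<Rightarrow> 'a \<Rightarrow> complex"
  assumes scaleC_add_right: "c *\<^sub>C (x + y) = c *\<^sub>C x + c *\<^sub>C y"
    and scaleC_add_left: "(c + d) *\<^sub>C x = c *\<^sub>C x + d *\<^sub>C x"
    and scaleC_scaleC: "c *\<^sub>C d *\<^sub>C x = (c * d) *\<^sub>C x"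
    and scaleC_of_real: "complex_of_real r *\<^sub>C x = r *\<^sub>R x"
    and cinner_commute: "cinner x y = cnj (cinner y x)"
    and cinner_add_left: "cinner (x + y) z = cinner x z + cinner y z"
    and cinner_scaleC_left: "cinner (c *\<^sub>C x) y = c * cinner x y"
    and Re_cinner: "Re (cinner x y) = inner x y"

lemma scaleC_one: "1 *\<^sub>C x = (x :: 'a::chilbert_space)"
  using scaleC_of_real[of 1 x] by simp

lemma cinner_scaleC_right: "cinner x (c *\<^sub>C y) = cnj c * cinner x (y :: 'a::chilbert_space)"
  by (metis cinner_commute cinner_scaleC_left complex_cnj_mult)

lemma cinner_self: "cinner x x = complex_of_real ((norm (x :: 'a::chilbert_space))\<^sup>2)"
proof (rule complex_eqI)
  show "Re (cinner x x) = Re (complex_of_real ((norm x)\<^sup>2))"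
    by (simp add: Re_cinner power2_norm_eq_inner del: of_real_power)
  have "Im (cinner x x) = - Im (cinner x x)"
    using arg_cong[OF cinner_commute[of x x], of Im] by simp
  then show "Im (cinner x x) = Im (complex_of_real ((norm x)\<^sup>2))"
    by (simp del: of_real_power)
qed

lemma norm_scaleC: "norm (c *\<^sub>C x) = cmod c * norm (x :: 'a::chilbert_space)"
proof -
  have "complex_of_real ((norm (c *\<^sub>C x))\<^sup>2) = (c * cnj c) * cinner x x"
    by (simp only: cinner_self[symmetric] cinner_scaleC_left cinner_scaleC_right mult.assoc mult.left_commute)
  also have "\<dots> = complex_of_real ((cmod c * norm x)\<^sup>2)"
    by (simp only: cinner_self complex_norm_square[symmetric] power_mult_distrib of_real_mult)
  finally have "(norm (c *\<^sub>C x))\<^sup>2 = (cmod c * norm x)\<^sup>2"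
    by (simp only: of_real_eq_iff)
  then show ?thesis
    by (rule power2_eq_imp_eq) auto
qed

lemma bounded_linear_scaleC: "bounded_linear (\<lambda>x :: 'a::chilbert_space. c *\<^sub>C x)"
proof (rule bounded_linear_intro)
  fix x y :: 'a and r :: real
  show "c *\<^sub>C (x + y) = c *\<^sub>C x + c *\<^sub>C y"
    by (rule scaleC_add_right)
  show "c *\<^sub>C (r *\<^sub>R x) = r *\<^sub>R (c *\<^sub>C x)"
    by (simp add: scaleC_of_real[symmetric] scaleC_scaleC mult.commute)
  show "norm (c *\<^sub>C x) \<le> norm x * cmod c"
    by (simp add: norm_scaleC mult.commute)
qed

text \<open>
  Elements of the type \<open>'h \<Rightarrow>\<^sub>L 'h\<close> are the bounded \<^emph>\<open>real\<close>-linear operators with the operator norm;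
  the algebra of bounded operators of a complex Hilbert space consists of the complex-linear ones.
\<close>

definition bounded_ops :: "('h::chilbert_space \<Rightarrow>\<^sub>L 'h) set" where
  "bounded_ops = {A. \<forall>c x. blinfun_apply A (c *\<^sub>C x) = c *\<^sub>C blinfun_apply A x}"

lift_definition scaleC_op :: "complex \<Rightarrow> ('h::chilbert_space \<Rightarrow>\<^sub>L 'h) \<Rightarrow> ('h \<Rightarrow>\<^sub>L 'h)"
  is "\<lambda>c A x. c *\<^sub>C A x"
  by (rule bounded_linear_compose[OF bounded_linear_scaleC])

definition adj :: "('h::chilbert_space \<Rightarrow>\<^sub>L 'h) \<Rightarrow> ('h \<Rightarrow>\<^sub>L 'h)" where
  "adj A = (THE B. \<forall>x y. cinner (blinfun_apply A x) y = cinner x (blinfun_apply B y))"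

text \<open>
  An \<open>n\<close>-tuple of operators is a family indexed by a finite type \<open>'n\<close> with \<open>CARD('n) = n\<close>.
\<close>

definition row_norm :: "('n::finite \<Rightarrow> 'h::chilbert_space \<Rightarrow>\<^sub>L 'h) \<Rightarrow> real" where
  "row_norm T = sqrt (norm (\<Sum>i\<in>UNIV. T i o\<^sub>L adj (T i)))"

definition open_row_ball :: "('n::finite \<Rightarrow> 'h::chilbert_space \<Rightarrow>\<^sub>L 'h) set" where
  "open_row_ball = {T. (\<forall>i. T i \<in> bounded_ops) \<and> row_norm T < 1}"


section \<open>Free holomorphic functions and the free analytic functional calculus\<close>

text \<open>
  The free semigroup on \<open>n\<close> generators is the type \<open>'n list\<close> of words (identity \<open>[]\<close>, product
  append), and a formal power series is its family of coefficients.
\<close>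

type_synonym 'n nc_series = "'n list \<Rightarrow> complex"

primrec word_op :: "('n \<Rightarrow> 'h::chilbert_space \<Rightarrow>\<^sub>L 'h) \<Rightarrow> 'n list \<Rightarrow> ('h \<Rightarrow>\<^sub>L 'h)" where
  "word_op T [] = id_blinfun"
| "word_op T (i # \<alpha>) = T i o\<^sub>L word_op T \<alpha>"

definition Hol :: "'n::finite nc_series set" where
  "Hol = {a. limsup (\<lambda>k. ereal ((\<Sum>\<alpha>\<in>{\<alpha>. length \<alpha> = k}. (cmod (a \<alpha>))\<^sup>2) powr (1 / (2 * real k)))) \<le> 1}"

definition func_calc :: "'n::finite nc_series \<Rightarrow> ('n \<Rightarrow> 'h::chilbert_space \<Rightarrow>\<^sub>L 'h) \<Rightarrow> ('h \<Rightarrow>\<^sub>L 'h)" where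
  "func_calc a T = (\<Sum>k. \<Sum>\<alpha>\<in>{\<alpha>. length \<alpha> = k}. scaleC_op (a \<alpha>) (word_op T \<alpha>))"


section \<open>The Hilbert space of square-summable families\<close>

typedef 'a ell2 = "{x :: 'a \<Rightarrow> complex. (\<lambda>i. (cmod (x i))\<^sup>2) summable_on UNIV}"
  morphisms ell2_coord Abs_ell2
  by (rule exI[of _ "\<lambda>_. 0"]) simp

setup_lifting type_definition_ell2

lemma ell2_coord_summable: "(\<lambda>i. (cmod (ell2_coord x i))\<^sup>2) summable_on UNIV"
  using ell2_coord[of x] by simp

lemma sq_summable_add:
  assumes "(\<lambda>i. (cmod (x i))\<^sup>2) summable_on UNIV" "(\<lambda>i. (cmod (y i))\<^sup>2) summable_on UNIV"
  shows "(\<lambda>i. (cmod (x i + y i))\<^sup>2) summable_on UNIV"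
proof -
  have le: "(cmod (x i + y i))\<^sup>2 \<le> 2 * ((cmod (x i))\<^sup>2 + (cmod (y i))\<^sup>2)" for i
  proof -
    have "(cmod (x i + y i))\<^sup>2 \<le> (cmod (x i) + cmod (y i))\<^sup>2"
      by (intro power_mono norm_triangle_ineq) auto
    also have "\<dots> \<le> 2 * ((cmod (x i))\<^sup>2 + (cmod (y i))\<^sup>2)"
      using sum_squares_bound[of "cmod (x i)" "cmod (y i)"] by (simp add: power2_sum)
    finally show ?thesis .
  qed
  show ?thesis
    by (rule summable_on_comparison_test[OF summable_on_cmult_right[OF summable_on_add[OF assms], of 2]])
       (use le in auto)
qed

lemma sq_summable_scale:
  assumes "(\<lambda>i. (cmod (x i))\<^sup>2) summable_on UNIV"
  shows "(\<lambda>i. (cmod (c * x i))\<^sup>2) summable_on UNIV"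
  using summable_on_cmult_right[OF assms, of "(cmod c)\<^sup>2"]
  by (simp add: norm_mult power_mult_distrib)

lemma ell2_prod_summable: "(\<lambda>i. ell2_coord x i * cnj (ell2_coord y i)) summable_on UNIV"
proof (rule abs_summable_summable, rule summable_on_comparison_test)
  show "(\<lambda>i. (cmod (ell2_coord x i))\<^sup>2 + (cmod (ell2_coord y i))\<^sup>2) summable_on UNIV"
    by (intro summable_on_add ell2_coord_summable)
  fix i
  show "norm (ell2_coord x i * cnj (ell2_coord y i)) \<le> (cmod (ell2_coord x i))\<^sup>2 + (cmod (ell2_coord y i))\<^sup>2"
    using sum_squares_bound[of "cmod (ell2_coord x i)" "cmod (ell2_coord y i)"]
      mult_nonneg_nonneg[OF norm_ge_zero norm_ge_zero, of "ell2_coord x i" "ell2_coord y i"]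
    unfolding norm_mult complex_mod_cnj mult.assoc by linarith
qed auto

definition ell2_cinner :: "'a ell2 \<Rightarrow> 'a ell2 \<Rightarrow> complex" where
  "ell2_cinner x y = (\<Sum>\<^sub>\<infinity>i. ell2_coord x i * cnj (ell2_coord y i))"

lemma ell2_cinner_self: "ell2_cinner x x = complex_of_real (\<Sum>\<^sub>\<infinity>i. (cmod (ell2_coord x i))\<^sup>2)"
proof -
  have "((\<lambda>i. complex_of_real ((cmod (ell2_coord x i))\<^sup>2)) has_sum
      complex_of_real (\<Sum>\<^sub>\<infinity>i. (cmod (ell2_coord x i))\<^sup>2)) UNIV"
    unfolding has_sum_of_real_iff by (rule has_sum_infsum[OF ell2_coord_summable])
  then show ?thesis
    unfolding ell2_cinner_def by (simp only: complex_norm_square infsumI)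
qed

instantiation ell2 :: (type) real_inner
begin

lift_definition zero_ell2 :: "'a ell2" is "\<lambda>_. 0"
  by simp

lift_definition plus_ell2 :: "'a ell2 \<Rightarrow> 'a ell2 \<Rightarrow> 'a ell2" is "\<lambda>x y i. x i + y i"
  by (rule sq_summable_add)

lift_definition uminus_ell2 :: "'a ell2 \<Rightarrow> 'a ell2" is "\<lambda>x i. - x i"
  by simp

lift_definition minus_ell2 :: "'a ell2 \<Rightarrow> 'a ell2 \<Rightarrow> 'a ell2" is "\<lambda>x y i. x i - y i"
  subgoal for x y using sq_summable_add[of x "\<lambda>i. - y i"] by simp
  done

lift_definition scaleR_ell2 :: "real \<Rightarrow> 'a ell2 \<Rightarrow> 'a ell2" is "\<lambda>r x i. complex_of_real r * x i"
  by (rule sq_summable_scale)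

definition inner_ell2 :: "'a ell2 \<Rightarrow> 'a ell2 \<Rightarrow> real" where
  "inner_ell2 x y = Re (ell2_cinner x y)"

definition norm_ell2 :: "'a ell2 \<Rightarrow> real" where
  "norm_ell2 x = sqrt (inner x x)"

definition sgn_ell2 :: "'a ell2 \<Rightarrow> 'a ell2" where
  "sgn_ell2 x = scaleR (inverse (norm x)) x"

definition dist_ell2 :: "'a ell2 \<Rightarrow> 'a ell2 \<Rightarrow> real" where
  "dist_ell2 x y = norm (x - y)"

definition uniformity_ell2 :: "('a ell2 \<times> 'a ell2) filter" where
  "uniformity_ell2 = (INF e\<in>{0<..}. principal {(x, y). dist x y < e})"

definition open_ell2 :: "'a ell2 set \<Rightarrow> bool" where
  "open_ell2 U = (\<forall>x\<in>U. \<forall>\<^sub>F (x', y) in uniformity. x' = x \<longrightarrow> y \<in> U)"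

instance
proof
  fix x y z :: "'a ell2" and r s :: real
  show "x + y + z = x + (y + z)" "x + y = y + x" "0 + x = x" "- x + x = 0" "x - y = x + - y"
    "r *\<^sub>R (x + y) = r *\<^sub>R x + r *\<^sub>R y" "(r + s) *\<^sub>R x = r *\<^sub>R x + s *\<^sub>R x"
    "r *\<^sub>R s *\<^sub>R x = (r * s) *\<^sub>R x" "1 *\<^sub>R x = x"
    by (transfer; auto simp: algebra_simps)+
  show "sgn x = inverse (norm x) *\<^sub>R x" "dist x y = norm (x - y)" "norm x = sqrt (inner x x)"
    by (simp_all add: sgn_ell2_def dist_ell2_def norm_ell2_def)
  show "(uniformity :: ('a ell2 \<times> 'a ell2) filter) = (INF e\<in>{0<..}. principal {(x, y). dist x y < e})"
    by (rule uniformity_ell2_def)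
  show "open U = (\<forall>x\<in>U. \<forall>\<^sub>F (x', y) in uniformity. x' = x \<longrightarrow> y \<in> U)" for U :: "'a ell2 set"
    by (rule open_ell2_def)
  have "ell2_cinner y x = cnj (ell2_cinner x y)"
    unfolding ell2_cinner_def infsum_cnj[symmetric] by (simp add: mult.commute)
  then show "inner x y = inner y x"
    by (simp add: inner_ell2_def)
  show "inner (x + y) z = inner x z + inner y z"
    unfolding inner_ell2_def ell2_cinner_def
    by (simp add: plus_ell2.rep_eq distrib_right infsum_add ell2_prod_summable)
  show "inner (r *\<^sub>R x) y = r * inner x y"
    unfolding inner_ell2_def ell2_cinner_def
    by (simp add: scaleR_ell2.rep_eq mult.assoc infsum_cmult_right')
  show "0 \<le> inner x x"
    by (simp add: inner_ell2_def ell2_cinner_self infsum_nonneg)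
  show "inner x x = 0 \<longleftrightarrow> x = 0"
  proof
    assume "inner x x = 0"
    then have "(\<Sum>\<^sub>\<infinity>i. (cmod (ell2_coord x i))\<^sup>2) \<le> 0"
      by (simp add: inner_ell2_def ell2_cinner_self)
    then have "(cmod (ell2_coord x i))\<^sup>2 = 0" for i
      by (rule nonneg_infsum_le_0D[OF _ ell2_coord_summable]) auto
    then show "x = 0"
      by (simp add: ell2_coord_inject[symmetric] zero_ell2.rep_eq fun_eq_iff)
  next
    assume "x = 0"
    then show "inner x x = 0"
      by (simp add: inner_ell2_def ell2_cinner_def zero_ell2.rep_eq)
  qed
qed

end

lemma norm_ell2_sq: "(norm x)\<^sup>2 = (\<Sum>\<^sub>\<infinity>i. (cmod (ell2_coord x i))\<^sup>2)"
  unfolding power2_norm_eq_inner[of x] inner_ell2_def ell2_cinner_self by simp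

lemma sum_coord_le_norm_ell2:
  assumes "finite F"
  shows "(\<Sum>i\<in>F. (cmod (ell2_coord x i))\<^sup>2) \<le> (norm x)\<^sup>2"
  unfolding norm_ell2_sq by (rule finite_sum_le_infsum) (use assms ell2_coord_summable in auto)

lemma cmod_coord_le_norm_ell2: "cmod (ell2_coord x i) \<le> norm x"
  by (rule power2_le_imp_le) (use sum_coord_le_norm_ell2[of "{i}" x] in auto)

instance ell2 :: (type) complete_space
proof
  fix X :: "nat \<Rightarrow> 'a ell2"
  assume X: "Cauchy X"
  have "Cauchy (\<lambda>n. ell2_coord (X n) i)" for i
  proof (rule metric_CauchyI)
    fix e :: real assume "e > 0"
    then obtain N where N: "\<And>m n. m \<ge> N \<Longrightarrow> n \<ge> N \<Longrightarrow> dist (X m) (X n) < e"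
      using metric_CauchyD[OF X] by blast
    have "dist (ell2_coord (X m) i) (ell2_coord (X n) i) \<le> dist (X m) (X n)" for m n
      using cmod_coord_le_norm_ell2[of "X m - X n" i] by (simp add: dist_norm minus_ell2.rep_eq)
    then show "\<exists>M. \<forall>m\<ge>M. \<forall>n\<ge>M. dist (ell2_coord (X m) i) (ell2_coord (X n) i) < e"
      using N by (meson order_le_less_trans)
  qed
  then obtain f where f: "\<And>i. (\<lambda>n. ell2_coord (X n) i) \<longlonglongrightarrow> f i"
    unfolding Cauchy_convergent_iff convergent_def by metis
  have fin: "(\<Sum>i\<in>F. (cmod (f i - ell2_coord (X n) i))\<^sup>2) \<le> e\<^sup>2"
    if "finite F" "e > 0" "\<And>m. m \<ge> n \<Longrightarrow> dist (X m) (X n) < e" for F n e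
  proof (rule tendsto_upperbound)
    show "(\<lambda>m. \<Sum>i\<in>F. (cmod (ell2_coord (X m) i - ell2_coord (X n) i))\<^sup>2)
        \<longlonglongrightarrow> (\<Sum>i\<in>F. (cmod (f i - ell2_coord (X n) i))\<^sup>2)"
      by (intro tendsto_intros f)
    have "(\<Sum>i\<in>F. (cmod (ell2_coord (X m) i - ell2_coord (X n) i))\<^sup>2) \<le> e\<^sup>2" if "m \<ge> n" for m
    proof -
      have "(\<Sum>i\<in>F. (cmod (ell2_coord (X m) i - ell2_coord (X n) i))\<^sup>2) \<le> (norm (X m - X n))\<^sup>2"
        using sum_coord_le_norm_ell2[OF \<open>finite F\<close>, of "X m - X n"] by (simp add: minus_ell2.rep_eq)
      also have "\<dots> \<le> e\<^sup>2"
        using \<open>\<And>m. m \<ge> n \<Longrightarrow> dist (X m) (X n) < e\<close>[OF that] by (intro power_mono) (auto simp: dist_norm)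
      finally show ?thesis .
    qed
    then show "\<forall>\<^sub>F m in sequentially. (\<Sum>i\<in>F. (cmod (ell2_coord (X m) i - ell2_coord (X n) i))\<^sup>2) \<le> e\<^sup>2"
      unfolding eventually_sequentially by blast
  qed simp
  have summ: "(\<lambda>i. (cmod (f i - ell2_coord (X n) i))\<^sup>2) summable_on UNIV"
    if "e > 0" "\<And>m. m \<ge> n \<Longrightarrow> dist (X m) (X n) < e" for n e
    by (rule nonneg_bdd_above_summable_on) (use fin[OF _ that] in \<open>auto intro!: bdd_aboveI\<close>)
  obtain N0 where N0: "\<And>m. m \<ge> N0 \<Longrightarrow> dist (X m) (X N0) < 1"
    using metric_CauchyD[OF X, of 1] by (metis order_refl zero_less_one)
  have f_summ: "(\<lambda>i. (cmod (f i))\<^sup>2) summable_on UNIV"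
    using sq_summable_add[OF summ[of 1 N0] ell2_coord_summable[of "X N0"]] N0 by simp
  define L where "L = Abs_ell2 f"
  have L: "ell2_coord L = f"
    unfolding L_def by (rule Abs_ell2_inverse) (use f_summ in simp)
  have "X \<longlonglongrightarrow> L"
  proof (rule metric_LIMSEQ_I)
    fix e :: real assume "e > 0"
    then obtain N where N: "\<And>m n. m \<ge> N \<Longrightarrow> n \<ge> N \<Longrightarrow> dist (X m) (X n) < e / 2"
      using metric_CauchyD[OF X, of "e / 2"] by auto
    have "dist (X n) L < e" if "n \<ge> N" for n
    proof -
      have d: "\<And>m. m \<ge> n \<Longrightarrow> dist (X m) (X n) < e / 2"
        using N that by (meson order_trans)
      have "(norm (L - X n))\<^sup>2 \<le> (e / 2)\<^sup>2"
        unfolding norm_ell2_sq minus_ell2.rep_eq L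
        by (rule infsum_le_finite_sums[OF summ[OF _ d] fin[OF _ _ d]]) (use \<open>e > 0\<close> in auto)
      then have "norm (L - X n) \<le> e / 2"
        by (rule power2_le_imp_le) (use \<open>e > 0\<close> in simp)
      then show ?thesis
        using \<open>e > 0\<close> by (simp add: dist_norm norm_minus_commute)
    qed
    then show "\<exists>no. \<forall>n\<ge>no. dist (X n) L < e"
      by blast
  qed
  then show "convergent X"
    by (rule convergentI)
qed

instantiation ell2 :: (type) chilbert_space
begin

lift_definition scaleC_ell2 :: "complex \<Rightarrow> 'a ell2 \<Rightarrow> 'a ell2" is "\<lambda>c x i. c * x i"
  by (rule sq_summable_scale)

definition cinner_ell2 :: "'a ell2 \<Rightarrow> 'a ell2 \<Rightarrow> complex" where
  "cinner_ell2 = ell2_cinner"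

instance
proof
  fix x y z :: "'a ell2" and c d :: complex and r :: real
  show "c *\<^sub>C (x + y) = c *\<^sub>C x + c *\<^sub>C y" "(c + d) *\<^sub>C x = c *\<^sub>C x + d *\<^sub>C x"
    "c *\<^sub>C d *\<^sub>C x = (c * d) *\<^sub>C x" "complex_of_real r *\<^sub>C x = r *\<^sub>R x"
    by (transfer; auto simp: algebra_simps)+
  show "cinner x y = cnj (cinner y x)"
    unfolding cinner_ell2_def ell2_cinner_def infsum_cnj[symmetric] by (simp add: mult.commute)
  show "cinner (x + y) z = cinner x z + cinner y z"
    unfolding cinner_ell2_def ell2_cinner_def
    by (simp add: plus_ell2.rep_eq distrib_right infsum_add ell2_prod_summable)
  show "cinner (c *\<^sub>C x) y = c * cinner x y"
    unfolding cinner_ell2_def ell2_cinner_def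
    by (simp add: scaleC_ell2.rep_eq mult.assoc infsum_cmult_right')
  show "Re (cinner x y) = inner x y"
    by (simp add: cinner_ell2_def inner_ell2_def)
qed

end


section \<open>The full Fock space and the left creation operators\<close>

text \<open>
  With \<open>H\<^sub>n = 'n ell2\<close> and \<open>e\<^sub>i\<close> its standard orthonormal basis, the \<open>m\<close>-th tensor power of \<open>H\<^sub>n\<close> is the
  space of functions on the words of length \<open>m\<close>, the word \<open>i\<^sub>1 \<dots> i\<^sub>m\<close> standing for the basis vector
  \<open>e\<^bsub>i\<^sub>1\<^esub> \<otimes> \<dots> \<otimes> e\<^bsub>i\<^sub>m\<^esub>\<close> and the empty word for the vacuum vector \<open>1\<close>. The Hilbert direct sum of
  these spaces is the space of square-summable families indexed by all words. In these coordinates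
  \<open>(v \<otimes> \<xi>) (j # \<alpha>) = v j * \<xi> \<alpha>\<close> and \<open>(v \<otimes> \<xi>) [] = 0\<close>, for \<open>v \<in> H\<^sub>n\<close> and \<open>\<xi>\<close> in the Fock space;
  the creation operator \<open>S\<^sub>i\<close> is the case \<open>v = e\<^sub>i\<close>.
\<close>

type_synonym 'n fock = "'n list ell2"

definition creation_coord :: "'n \<Rightarrow> ('n list \<Rightarrow> complex) \<Rightarrow> 'n list \<Rightarrow> complex" where
  "creation_coord i \<xi> \<beta> = (case \<beta> of [] \<Rightarrow> 0 | j # \<alpha> \<Rightarrow> of_bool (j = i) * \<xi> \<alpha>)"

lemma creation_coord_sq_has_sum:
  assumes "(\<lambda>\<alpha>. (cmod (\<xi> \<alpha>))\<^sup>2) summable_on UNIV"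
  shows "((\<lambda>\<beta>. (cmod (creation_coord i \<xi> \<beta>))\<^sup>2) has_sum (\<Sum>\<^sub>\<infinity>\<alpha>. (cmod (\<xi> \<alpha>))\<^sup>2)) UNIV"
proof -
  have "((\<lambda>\<alpha>. (cmod (\<xi> \<alpha>))\<^sup>2) has_sum (\<Sum>\<^sub>\<infinity>\<alpha>. (cmod (\<xi> \<alpha>))\<^sup>2)) UNIV"
    by (rule has_sum_infsum[OF assms])
  then have "((\<lambda>\<beta>. (cmod (creation_coord i \<xi> \<beta>))\<^sup>2) has_sum (\<Sum>\<^sub>\<infinity>\<alpha>. (cmod (\<xi> \<alpha>))\<^sup>2)) (range ((#) i))"
    by (subst has_sum_reindex) (auto simp: inj_on_def creation_coord_def comp_def)
  then show ?thesis
    by (subst has_sum_cong_neutral[where T = "range ((#) i)"])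
       (auto simp: creation_coord_def image_iff split: list.splits)
qed

lift_definition creation_vec :: "'n \<Rightarrow> 'n fock \<Rightarrow> 'n fock" is creation_coord
  by (blast intro: has_sum_imp_summable creation_coord_sq_has_sum)

lift_definition creation :: "'n \<Rightarrow> ('n fock \<Rightarrow>\<^sub>L 'n fock)" is creation_vec
proof (rule bounded_linear_intro)
  fix i :: 'n and x y :: "'n fock" and r :: real
  show "creation_vec i (x + y) = creation_vec i x + creation_vec i y"
    "creation_vec i (r *\<^sub>R x) = r *\<^sub>R creation_vec i x"
    by (transfer; auto simp: creation_coord_def fun_eq_iff algebra_simps split: list.split)+
  have "(norm (creation_vec i x))\<^sup>2 = (norm x)\<^sup>2"
    unfolding norm_ell2_sq creation_vec.rep_eq
    by (rule infsumI creation_coord_sq_has_sum ell2_coord_summable)+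
  then show "norm (creation_vec i x) \<le> norm x * 1"
    by simp
qed


section \<open>The Hardy type spaces\<close>

definition radial_norm :: "'n::finite nc_series \<Rightarrow> real \<Rightarrow> real" where
  "radial_norm f r = norm (func_calc f (\<lambda>i. r *\<^sub>R creation i))"

text \<open>
  The series defining \<open>f(rS\<^sub>1, \<dots>, rS\<^sub>n)\<close> converges for \<open>0 \<le> r < 1\<close>; for \<open>r = 1\<close> it may diverge, but a
  single point is negligible for membership in \<open>L\<^sup>p[0,1]\<close> and for the integral.
\<close>

definition Hp :: "real \<Rightarrow> 'n::finite nc_series set" where
  "Hp p = {f \<in> Hol. set_borel_measurable lebesgue {0..1} (radial_norm f)
                  \<and> set_integrable lebesgue {0..1} (\<lambda>r. radial_norm f r powr p)}"

definition Hp_norm :: "real \<Rightarrow> 'n::finite nc_series \<Rightarrow> real" where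
  "Hp_norm p f = (LINT r:{0..1}|lebesgue. radial_norm f r powr p) powr (1 / p)"

end

theory Submission
  imports Defs
begin

text \<open>
  The key is the noncommutative von Neumann inequality: for \<open>\<parallel>[T\<^sub>1, \<dots>, T\<^sub>n]\<parallel> < r < 1\<close> one has
  \<open>\<parallel>f(T)\<parallel> \<le> \<parallel>f(rS)\<parallel>\<close>. Integrating the \<open>p\<close>-th power over \<open>r\<close> between \<open>\<parallel>T\<parallel>\<close> and \<open>1\<close> gives
  \<open>(1 - \<parallel>T\<parallel>) \<parallel>f(T)\<parallel>\<^sup>p \<le> \<parallel>f\<parallel>\<^sub>p\<^sup>p\<close>, and continuity follows from linearity. The inequality is proved
  for polynomials by a finite version of the Poisson kernel argument that needs neither operator
  square roots nor Hilbert space tensor products.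
\<close>

section \<open>Adjoints\<close>

instance chilbert_space \<subseteq> banach ..

text \<open>The functional \<open>J x = inner x x - 2 * \<phi> x\<close> is bounded below, and its
  minimiser \<open>z\<close> represents \<open>\<phi>\<close> because the first variation vanishes
  there. Minimising sequences are Cauchy by the parallelogram law.\<close>

lemma riesz_representation:
  fixes \<phi> :: "'a::{real_inner,complete_space} \<Rightarrow> real"
  assumes "bounded_linear \<phi>"
  shows "\<exists>z. \<forall>x. \<phi> x = inner x z"
proof -
  interpret bounded_linear \<phi> by fact
  obtain K where K: "\<And>x. norm (\<phi> x) \<le> norm x * K"
    using bounded by blast
  define J where "J x = inner x x - 2 * \<phi> x" for x
  have J_ge: "- K\<^sup>2 \<le> J x" for x
  proof -
    have "\<phi> x \<le> norm x * K" using K[of x] by simp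
    moreover have "0 \<le> (norm x - K)\<^sup>2" by simp
    ultimately show ?thesis
      unfolding J_def power2_norm_eq_inner[symmetric] by (simp add: power2_diff)
  qed
  define m where "m = (INF x. J x)"
  have bdd: "bdd_below (range J)" using J_ge by (auto intro!: bdd_belowI)
  have m_le: "m \<le> J x" for x unfolding m_def by (rule cINF_lower[OF bdd]) simp
  have "\<exists>x. J x < m + 1 / real (Suc n)" for n
    using cINF_less_iff[OF _ bdd, of "m + 1 / real (Suc n)"] by (simp add: m_def)
  then obtain x where x: "\<And>n. J (x n) < m + 1 / real (Suc n)" by metis
  \<comment> \<open>The linear terms of \<open>J\<close> cancel against the midpoint; what remains
    is the parallelogram law.\<close>
  have par: "inner (u - v) (u - v) = 2 * (J u + J v - 2 * J ((1/2) *\<^sub>R (u + v)))" for u v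
    unfolding J_def scaleR add by (simp add: inner_simps inner_commute algebra_simps)
  have close: "(norm (x i - x j))\<^sup>2 < 4 / real (Suc N)" if "i \<ge> N" "j \<ge> N" for i j N
  proof -
    have "1 / real (Suc i) \<le> 1 / real (Suc N)" "1 / real (Suc j) \<le> 1 / real (Suc N)"
      using that by (auto intro!: divide_left_mono)
    then have "J (x i) < m + 1 / real (Suc N)" "J (x j) < m + 1 / real (Suc N)"
      using x[of i] x[of j] by (meson add_left_mono order_less_le_trans)+
    then have "2 * (J (x i) + J (x j) - 2 * J ((1/2) *\<^sub>R (x i + x j))) < 4 * (1 / real (Suc N))"
      using m_le[of "(1/2) *\<^sub>R (x i + x j)"] by argo
    then show ?thesis
      unfolding power2_norm_eq_inner par by simp
  qed
  have "Cauchy x"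
  proof (rule metric_CauchyI)
    fix e :: real assume "e > 0"
    then obtain N where N: "1 / real (Suc N) < e\<^sup>2 / 4"
      using reals_Archimedean[of "e\<^sup>2 / 4"] by (auto simp: inverse_eq_divide)
    have "dist (x i) (x j) < e" if "i \<ge> N" "j \<ge> N" for i j
      unfolding dist_norm
      by (rule power2_less_imp_less) (use close[OF that] N \<open>e > 0\<close> in auto)
    then show "\<exists>M. \<forall>i\<ge>M. \<forall>j\<ge>M. dist (x i) (x j) < e" by blast
  qed
  then obtain z where z: "x \<longlonglongrightarrow> z"
    by (auto simp: Cauchy_convergent_iff convergent_def)
  have "J z \<le> m"
  proof (rule tendsto_le[OF trivial_limit_sequentially])
    show "(\<lambda>n. J (x n)) \<longlonglongrightarrow> J z"
      unfolding J_def by (intro tendsto_intros z tendsto)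
    show "(\<lambda>n. m + 1 / real (Suc n)) \<longlonglongrightarrow> m"
      using tendsto_add[OF tendsto_const LIMSEQ_inverse_real_of_nat, of m] by (simp add: inverse_eq_divide)
  qed (use x in \<open>auto intro!: always_eventually less_imp_le\<close>)
  then have min: "J z \<le> J y" for y using m_le[of y] by simp
  have "\<phi> y = inner y z" for y
  proof (rule ccontr)
    assume ne: "\<phi> y \<noteq> inner y z"
    define d where "d = \<phi> y - inner y z"
    have y: "inner y y > 0" using ne zero by (cases "y = 0") auto
    \<comment> \<open>This \<open>t\<close> minimises the quadratic
      \<open>J (z + t *\<^sub>R y)\<close>.\<close>
    define t where "t = d / inner y y"
    have "J (z + t *\<^sub>R y) = J z - 2 * t * d + t * (t * inner y y)"
      unfolding J_def add scaleR d_def by (simp add: inner_simps inner_commute algebra_simps)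
    also have "\<dots> = J z - d\<^sup>2 / inner y y"
      using y by (simp add: t_def field_simps power2_eq_square)
    also have "\<dots> < J z" using y ne by (simp add: d_def)
    finally show False using min[of "z + t *\<^sub>R y"] by simp
  qed
  then show ?thesis by blast
qed

lemma cinner_add_right: "cinner x (y + z) = cinner x y + cinner x (z :: 'a::chilbert_space)"
  by (metis cinner_add_left cinner_commute complex_cnj_add)

lemma cinner_zero_left: "cinner 0 (x :: 'a::chilbert_space) = 0"
  using cinner_add_left[of 0 0 x] by simp

lemma cinner_zero_right: "cinner (x :: 'a::chilbert_space) 0 = 0"
  using cinner_add_right[of x 0 0] by simp

lemma cinner_sum_left: "cinner (\<Sum>i\<in>I. f i) (x :: 'a::chilbert_space) = (\<Sum>i\<in>I. cinner (f i) x)"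
  by (induction I rule: infinite_finite_induct) (auto simp: cinner_zero_left cinner_add_left)

lemma cinner_sum_right: "cinner (x :: 'a::chilbert_space) (\<Sum>i\<in>I. f i) = (\<Sum>i\<in>I. cinner x (f i))"
  by (induction I rule: infinite_finite_induct) (auto simp: cinner_zero_right cinner_add_right)

lemma Im_cinner: "Im (cinner x y) = inner ((- \<i>) *\<^sub>C x) (y :: 'a::chilbert_space)"
  by (simp add: Re_cinner[symmetric] cinner_scaleC_left)

lemma cinner_eq_imp_eq:
  fixes y z :: "'a::chilbert_space"
  assumes "\<And>x. cinner x y = cinner x z"
  shows "y = z"
  using assms by (metis Re_cinner vector_eq_ldot)

lemma bounded_opsD: "A \<in> bounded_ops \<Longrightarrow> A (c *\<^sub>C x) = c *\<^sub>C A x"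
  by (simp add: bounded_ops_def)

text \<open>Riesz gives the adjoint for the real inner product first; complex linearity of
  \<open>A\<close> carries the identity over to the imaginary part of \<open>cinner\<close>.\<close>

lemma adjoint_exists:
  assumes "A \<in> bounded_ops"
  shows "\<exists>B. \<forall>x y. cinner (blinfun_apply A x) y = cinner x (blinfun_apply B y)"
proof -
  have "\<exists>z. \<forall>x. inner (A x) y = inner x z" for y
    by (rule riesz_representation) (intro bounded_linear_intros)
  then obtain b where b: "\<And>x y. inner (A x) y = inner x (b y)" by metis
  have "bounded_linear b"
  proof (rule bounded_linear_intro)
    fix x y and r :: real
    show "b (x + y) = b x + b y"
      by (metis (no_types, lifting) b inner_add_right vector_eq_ldot)
    show "b (r *\<^sub>R x) = r *\<^sub>R b x"
      by (metis (no_types, lifting) b inner_scaleR_right vector_eq_ldot)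
    have "norm (b x) * norm (b x) = inner (A (b x)) x"
      by (simp add: b power2_norm_eq_inner[symmetric] power2_eq_square)
    also have "\<dots> \<le> norm A * norm (b x) * norm x"
      by (meson norm_blinfun norm_cauchy_schwarz mult_right_mono norm_ge_zero order_trans)
    finally have "norm (b x) * norm (b x) \<le> norm (b x) * (norm x * norm A)"
      by (simp add: mult_ac)
    then show "norm (b x) \<le> norm x * norm A"
      by (cases "b x = 0") (auto simp: mult_le_cancel_left_pos)
  qed
  then have "blinfun_apply (Blinfun b) y = b y" for y
    by (simp add: bounded_linear_Blinfun_apply)
  moreover have "cinner (A x) y = cinner x (b y)" for x y
    by (rule complex_eqI) (simp_all add: Re_cinner Im_cinner b bounded_opsD[OF assms, symmetric])
  ultimately show ?thesis by metis
qed

lemma adj_eqI: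
  assumes "\<And>x y. cinner (blinfun_apply A x) y = cinner x (blinfun_apply B y)"
  shows "adj A = B"
  unfolding adj_def
proof (rule the_equality)
  fix B' assume B': "\<forall>x y. cinner (blinfun_apply A x) y = cinner x (blinfun_apply B' y)"
  show "B' = B"
    by (rule blinfun_eqI, rule cinner_eq_imp_eq) (metis B' assms)
qed (use assms in blast)

lemma cinner_adj:
  assumes "A \<in> bounded_ops"
  shows "cinner (blinfun_apply A x) y = cinner x (blinfun_apply (adj A) y)"
proof -
  obtain B where B: "\<And>x y. cinner (blinfun_apply A x) y = cinner x (blinfun_apply B y)"
    using adjoint_exists[OF assms] by blast
  show ?thesis unfolding adj_eqI[OF B] by (rule B)
qed

lemma cinner_adj_left:
  assumes "A \<in> bounded_ops"
  shows "cinner (blinfun_apply (adj A) x) y = cinner x (blinfun_apply A y)"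
  by (metis assms cinner_adj cinner_commute)

lemma adj_bounded_ops: "A \<in> bounded_ops \<Longrightarrow> adj A \<in> bounded_ops"
  unfolding bounded_ops_def[of] mem_Collect_eq
  by (intro allI cinner_eq_imp_eq)
     (simp add: cinner_adj[symmetric] cinner_scaleC_right bounded_ops_def)

lemma adj_adj: "A \<in> bounded_ops \<Longrightarrow> adj (adj A) = A"
  by (rule adj_eqI) (rule cinner_adj_left)

lemma norm_adj_le:
  assumes "A \<in> bounded_ops"
  shows "norm (adj A) \<le> norm A"
proof (rule norm_blinfun_bound)
  fix x
  have "(norm (adj A x))\<^sup>2 = inner (A (adj A x)) x"
    by (simp add: power2_norm_eq_inner Re_cinner[symmetric] cinner_adj[OF assms])
  also have "\<dots> \<le> norm A * norm (adj A x) * norm x"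
    by (meson norm_blinfun norm_cauchy_schwarz mult_right_mono norm_ge_zero order_trans)
  finally have "norm (adj A x) * norm (adj A x) \<le> norm (adj A x) * (norm A * norm x)"
    by (simp add: mult_ac power2_eq_square)
  then show "norm (adj A x) \<le> norm A * norm x"
    by (cases "adj A x = 0") (auto simp: mult_le_cancel_left_pos)
qed simp

lemma norm_adj: "A \<in> bounded_ops \<Longrightarrow> norm (adj A) = norm A"
  using norm_adj_le[of A] norm_adj_le[of "adj A"] by (simp add: adj_adj adj_bounded_ops)

section \<open>Operations on complex-linear operators and their adjoints\<close>

lemma compose_bounded_ops: "A \<in> bounded_ops \<Longrightarrow> B \<in> bounded_ops \<Longrightarrow> A o\<^sub>L B \<in> bounded_ops"
  by (simp add: bounded_ops_def)

lemma id_bounded_ops: "id_blinfun \<in> bounded_ops"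
  by (simp add: bounded_ops_def)

lemma scaleC_op_bounded_ops: "A \<in> bounded_ops \<Longrightarrow> scaleC_op c A \<in> bounded_ops"
  by (simp add: bounded_ops_def scaleC_op.rep_eq scaleC_scaleC mult.commute)

lemma scaleC_sum: "c *\<^sub>C (\<Sum>i\<in>I. f i) = (\<Sum>i\<in>I. c *\<^sub>C (f i :: 'a::chilbert_space))"
  by (rule linear_sum[OF bounded_linear.linear[OF bounded_linear_scaleC]])

lemma blinfun_apply_sum: "blinfun_apply (\<Sum>i\<in>I. A i) x = (\<Sum>i\<in>I. blinfun_apply (A i) x)"
  by (induction I rule: infinite_finite_induct) (auto simp: blinfun.bilinear_simps)

lemma sum_bounded_ops: "(\<And>i. i \<in> I \<Longrightarrow> A i \<in> bounded_ops) \<Longrightarrow> (\<Sum>i\<in>I. A i) \<in> bounded_ops"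
  by (auto simp: bounded_ops_def blinfun_apply_sum scaleC_sum intro!: sum.cong)

lemma scaleR_bounded_ops: "A \<in> bounded_ops \<Longrightarrow> r *\<^sub>R A \<in> bounded_ops"
  by (simp add: bounded_ops_def scaleC_of_real[symmetric] scaleC_scaleC mult.commute blinfun.scaleR_left)

text \<open>Needed to place \<open>func_calc\<close>, a norm limit of polynomials, among the
  complex-linear operators.\<close>

lemma closed_bounded_ops: "closed (bounded_ops :: ('h::chilbert_space \<Rightarrow>\<^sub>L 'h) set)"
proof -
  have "bounded_ops = (\<Inter>c. \<Inter>x. {A :: 'h \<Rightarrow>\<^sub>L 'h. A (c *\<^sub>C x) = c *\<^sub>C A x})"
    by (auto simp: bounded_ops_def)
  also have "closed \<dots>"
    by (intro closed_INT ballI closed_Collect_eq bounded_linear.continuous_on[OF bounded_linear_scaleC]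
        continuous_intros)
  finally show ?thesis .
qed

lemma adj_scaleR:
  assumes "A \<in> bounded_ops"
  shows "adj (r *\<^sub>R A) = r *\<^sub>R adj A"
proof (rule adj_eqI)
  fix x y
  show "cinner ((r *\<^sub>R A) x) y = cinner x ((r *\<^sub>R adj A) y)"
    unfolding blinfun.scaleR_left scaleC_of_real[symmetric] cinner_scaleC_left cinner_scaleC_right
      cinner_adj[OF assms] by simp
qed

lemma adj_compose:
  assumes "A \<in> bounded_ops" "B \<in> bounded_ops"
  shows "adj (A o\<^sub>L B) = adj B o\<^sub>L adj A"
  by (rule adj_eqI) (simp add: cinner_adj[OF assms(1)] cinner_adj[OF assms(2)])

lemma adj_id: "adj id_blinfun = id_blinfun"
  by (rule adj_eqI) simp

lemma adj_sum_scaleC: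
  assumes "\<And>i. i \<in> I \<Longrightarrow> A i \<in> bounded_ops"
  shows "adj (\<Sum>i\<in>I. scaleC_op (c i) (A i)) = (\<Sum>i\<in>I. scaleC_op (cnj (c i)) (adj (A i)))"
proof (rule adj_eqI)
  fix x y
  show "cinner ((\<Sum>i\<in>I. scaleC_op (c i) (A i)) x) y = cinner x ((\<Sum>i\<in>I. scaleC_op (cnj (c i)) (adj (A i))) y)"
    unfolding blinfun_apply_sum cinner_sum_left cinner_sum_right scaleC_op.rep_eq
      cinner_scaleC_left cinner_scaleC_right complex_cnj_cnj
    by (intro sum.cong refl arg_cong2[where f = "(*)"] cinner_adj assms)
qed


section \<open>Positive semidefinite forms\<close>

text \<open>Axiomatises the properties of the inner product of \<open>\<Delta> x\<close> and
  \<open>\<Delta> y\<close> without naming a square root \<open>\<Delta>\<close>. Null vectors must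
  be allowed, since deflation creates them.\<close>

locale psd_form =
  fixes B :: "'a::chilbert_space \<Rightarrow> 'a \<Rightarrow> complex"
  assumes add_left: "B (x + y) z = B x z + B y z"
    and scale_left: "B (c *\<^sub>C x) y = c * B x y"
    and commute: "B x y = cnj (B y x)"
    and nonneg: "0 \<le> Re (B x x)"
begin

lemma add_right: "B x (y + z) = B x y + B x z"
  unfolding commute[of x] add_left by simp

lemma scale_right: "B x (c *\<^sub>C y) = cnj c * B x y"
  unfolding commute[of x] scale_left by simp

lemma sum_left: "B (\<Sum>i\<in>I. f i) x = (\<Sum>i\<in>I. B (f i) x)"
proof -
  have "B 0 x = 0" using add_left[of 0 0 x] by simp
  then show ?thesis
    by (induction I rule: infinite_finite_induct) (auto simp: add_left)
qed

lemma self: "B x x = complex_of_real (Re (B x x))"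
  using arg_cong[OF commute[of x x], of Im] by (simp add: complex_eq_iff)

lemma cauchy_schwarz: "(cmod (B x y))\<^sup>2 \<le> Re (B x x) * Re (B y y)"
proof -
  define b where "b = B x y"
  have yx: "B y x = cnj b" unfolding b_def by (rule commute)
  \<comment> \<open>Nonnegativity at \<open>x\<close> minus \<open>t * B x y\<close> times
    \<open>y\<close>: this phase makes both cross terms real and leaves a real quadratic in
    \<open>t\<close>.\<close>
  have ge: "0 \<le> Re (B x x) - 2 * t * (cmod b)\<^sup>2 + t\<^sup>2 * (cmod b)\<^sup>2 * Re (B y y)" for t :: real
  proof -
    define c where "c = - (complex_of_real t * b)"
    have "B (x + c *\<^sub>C y) (x + c *\<^sub>C y) = B x x + cnj c * b + c * cnj b + c * cnj c * B y y"
      unfolding add_left add_right scale_left scale_right yx b_def[symmetric] by (simp add: algebra_simps)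
    also have "cnj c * b = - complex_of_real (t * (cmod b)\<^sup>2)"
      unfolding c_def of_real_mult complex_norm_square by (simp add: mult_ac)
    also have "c * cnj b = - complex_of_real (t * (cmod b)\<^sup>2)"
      unfolding c_def of_real_mult complex_norm_square by (simp add: mult_ac)
    also have "c * cnj c * B y y = complex_of_real (t\<^sup>2 * (cmod b)\<^sup>2 * Re (B y y))"
      unfolding of_real_mult self[of y, symmetric] complex_norm_square c_def
      by (simp add: power2_eq_square mult_ac)
    finally show ?thesis using nonneg[of "x + c *\<^sub>C y"] by simp
  qed
  show ?thesis
  proof (cases "Re (B y y) = 0")
    case True
    \<comment> \<open>Here the quadratic is affine in \<open>t\<close>; for nonzero \<open>b\<close>
      the chosen \<open>t\<close> would give it the value -1.\<close>
    have "b = 0"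
    proof (rule ccontr)
      assume "b \<noteq> 0"
      then show False
        using ge[of "(Re (B x x) + 1) / (2 * (cmod b)\<^sup>2)"] True by simp
    qed
    then show ?thesis using True by (simp add: b_def)
  next
    case False
    then have Y: "Re (B y y) > 0" using nonneg[of y] by simp
    then show ?thesis
      using ge[of "1 / Re (B y y)"] by (simp add: b_def[symmetric] field_simps power2_eq_square)
  qed
qed

text \<open>If \<open>B w w = 0\<close> then \<open>B x w = 0\<close> by Cauchy--Schwarz, so the junk value of the division is harmless.\<close>

lemma Re_deflate:
  "Re (B x x - B x w * B w x / B w w) = Re (B x x) - (cmod (B x w))\<^sup>2 / Re (B w w)"
proof -
  have "B x w * B w x / B w w = complex_of_real ((cmod (B x w))\<^sup>2 / Re (B w w))"
    unfolding of_real_divide complex_norm_square self[of w, symmetric] commute[of w x] ..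
  then show ?thesis by simp
qed

text \<open>The Schur complement of \<open>w\<close>: the form of the components
  \<open>B\<close>-orthogonal to \<open>w\<close>, or \<open>B\<close> itself if \<open>w\<close> is
  null. Its nonnegativity is Cauchy--Schwarz.\<close>

lemma deflate: "psd_form (\<lambda>x y. B x y - B x w * B w y / B w w)"
proof
  fix x y z c
  show "B (x + y) z - B (x + y) w * B w z / B w w
    = B x z - B x w * B w z / B w w + (B y z - B y w * B w z / B w w)"
    by (simp add: add_left ring_distribs add_divide_distrib)
  show "B (c *\<^sub>C x) y - B (c *\<^sub>C x) w * B w y / B w w = c * (B x y - B x w * B w y / B w w)"
    by (simp add: scale_left algebra_simps)
  show "B x y - B x w * B w y / B w w = cnj (B y x - B y w * B w x / B w w)"
    by (simp add: commute[of x y] commute[of x w] commute[of w y] commute[of w w, symmetric] mult.commute)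
  show "0 \<le> Re (B x x - B x w * B w x / B w w)"
    unfolding Re_deflate using cauchy_schwarz[of x w] nonneg[of x] nonneg[of w]
    by (cases "Re (B w w) = 0") (auto simp: divide_le_eq)
qed

end

text \<open>
  Boundedness of \<open>M \<otimes> I\<close> for a bounded scalar matrix \<open>M\<close>. Splitting off the rank one form
  \<open>B x w * B w y / B w w\<close>, to which the scalar estimate applies directly, makes \<open>w\<close> a null vector of
  the remaining form; the induction does this for one \<open>w g\<close> after the other.
\<close>

lemma psd_form_matrix_bound:
  fixes w :: "'g \<Rightarrow> 'a::chilbert_space" and m :: "'f \<Rightarrow> 'b \<Rightarrow> complex"
  assumes bound: "\<And>\<xi> :: 'g \<Rightarrow> complex.
      (\<Sum>\<beta>\<in>F. (cmod (\<Sum>\<alpha>\<in>A. m \<beta> \<alpha> * \<xi> (\<phi> \<beta> \<alpha>)))\<^sup>2) \<le> C * (\<Sum>\<gamma>\<in>G. (cmod (\<xi> \<gamma>))\<^sup>2)"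
    and \<phi>: "\<And>\<beta> \<alpha>. \<beta> \<in> F \<Longrightarrow> \<alpha> \<in> A \<Longrightarrow> \<phi> \<beta> \<alpha> \<in> G"
    and "finite G" and "psd_form B"
  defines "u \<equiv> \<lambda>\<beta>. \<Sum>\<alpha>\<in>A. m \<beta> \<alpha> *\<^sub>C w (\<phi> \<beta> \<alpha>)"
  shows "(\<Sum>\<beta>\<in>F. Re (B (u \<beta>) (u \<beta>))) \<le> C * (\<Sum>\<gamma>\<in>G. Re (B (w \<gamma>) (w \<gamma>)))"
proof -
  \<comment> \<open>Generalised for the induction: \<open>K\<close> holds the indices whose vectors
    may still be non-null, and the form varies because each step deflates it. The claim is the case
    \<open>K = G\<close>.\<close>
  have "(\<Sum>\<beta>\<in>F. Re (B (u \<beta>) (u \<beta>))) \<le> C * (\<Sum>\<gamma>\<in>G. Re (B (w \<gamma>) (w \<gamma>)))"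
    if "finite K" "psd_form B" "\<And>\<gamma>. \<gamma> \<in> G - K \<Longrightarrow> Re (B (w \<gamma>) (w \<gamma>)) = 0" for K B
    using that
  proof (induction K arbitrary: B rule: finite_induct)
    case empty
    interpret psd_form B by fact
    \<comment> \<open>By Cauchy--Schwarz a null vector pairs to zero with everything, so every
      \<open>u \<beta>\<close> is null too.\<close>
    have "B (w \<gamma>) x = 0" if "\<gamma> \<in> G" for \<gamma> x
      using cauchy_schwarz[of "w \<gamma>" x] empty(2)[of \<gamma>] that by simp
    then have "B (u \<beta>) (u \<beta>) = 0" if "\<beta> \<in> F" for \<beta>
      using \<phi> that unfolding u_def sum_left scale_left by (intro sum.neutral) auto
    then show ?case using empty(2) by simp
  next
    case (insert g K)
    interpret psd_form B by fact
    let ?w = "w g"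
    define B' where "B' = (\<lambda>x y. B x y - B x ?w * B ?w y / B ?w ?w)"
    interpret B': psd_form B' unfolding B'_def by (rule deflate)
    have split: "Re (B x x) = Re (B' x x) + (cmod (B x ?w))\<^sup>2 / Re (B ?w ?w)" for x
      unfolding B'_def Re_deflate by simp
    have "Re (B' (w \<gamma>) (w \<gamma>)) = 0" if "\<gamma> \<in> G - K" for \<gamma>
    proof (cases "\<gamma> = g")
      case True
      then show ?thesis by (simp add: B'_def)
    next
      case False
      then have "Re (B (w \<gamma>) (w \<gamma>)) = 0" using insert.prems(2) that by auto
      \<comment> \<open>Deflation only decreases the form on the diagonal, so null vectors stay
        null.\<close>
      moreover have "0 \<le> (cmod (B (w \<gamma>) ?w))\<^sup>2 / Re (B ?w ?w)" using nonneg by simp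
      ultimately show ?thesis using split[of "w \<gamma>"] B'.nonneg[of "w \<gamma>"] by linarith
    qed
    then have IH: "(\<Sum>\<beta>\<in>F. Re (B' (u \<beta>) (u \<beta>))) \<le> C * (\<Sum>\<gamma>\<in>G. Re (B' (w \<gamma>) (w \<gamma>)))"
      using insert.IH[of B'] B'.psd_form_axioms by blast
    \<comment> \<open>The scalar hypothesis with \<open>\<xi> \<gamma> = B (w \<gamma>) ?w\<close>
      controls the rank one part; added to the estimate for \<open>B'\<close> it gives the one for
      \<open>B\<close>.\<close>
    have "(\<Sum>\<beta>\<in>F. (cmod (B (u \<beta>) ?w))\<^sup>2) \<le> C * (\<Sum>\<gamma>\<in>G. (cmod (B (w \<gamma>) ?w))\<^sup>2)"
      using bound[of "\<lambda>\<gamma>. B (w \<gamma>) ?w"] by (simp add: u_def sum_left scale_left)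
    then have "(\<Sum>\<beta>\<in>F. (cmod (B (u \<beta>) ?w))\<^sup>2) / Re (B ?w ?w)
        \<le> C * (\<Sum>\<gamma>\<in>G. (cmod (B (w \<gamma>) ?w))\<^sup>2) / Re (B ?w ?w)"
      using nonneg[of ?w] by (rule divide_right_mono)
    moreover have "(\<Sum>\<beta>\<in>F. Re (B (u \<beta>) (u \<beta>))) = (\<Sum>\<beta>\<in>F. Re (B' (u \<beta>) (u \<beta>)))
        + (\<Sum>\<beta>\<in>F. (cmod (B (u \<beta>) ?w))\<^sup>2) / Re (B ?w ?w)"
      unfolding sum_divide_distrib sum.distrib[symmetric] by (rule sum.cong[OF refl split])
    moreover have "(\<Sum>\<gamma>\<in>G. Re (B (w \<gamma>) (w \<gamma>))) = (\<Sum>\<gamma>\<in>G. Re (B' (w \<gamma>) (w \<gamma>)))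
        + (\<Sum>\<gamma>\<in>G. (cmod (B (w \<gamma>) ?w))\<^sup>2) / Re (B ?w ?w)"
      unfolding sum_divide_distrib sum.distrib[symmetric] by (rule sum.cong[OF refl split])
    ultimately show ?case
      using IH by (simp add: ring_distribs)
  qed
  from this[of G B] show ?thesis using assms(3,4) by simp
qed


section \<open>Words in row contractions\<close>

lemma finite_words [simp]: "finite {\<alpha> :: 'n::finite list. length \<alpha> = k}"
  using finite_lists_length_eq[of "UNIV :: 'n set" k] by simp

lemma finite_words_le [simp]: "finite {\<alpha> :: 'n::finite list. length \<alpha> \<le> k}"
  using finite_lists_length_le[of "UNIV :: 'n set" k] by simp

text \<open>The last letter is split off, not the first, because adjoints reverse products: the
  adjoint of \<open>\<alpha> @ [i]\<close> applies \<open>adj (X i)\<close> after the adjoint of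
  \<open>\<alpha>\<close>.\<close>

lemma sum_words_Suc:
  fixes f :: "'n::finite list \<Rightarrow> 'a::comm_monoid_add"
  shows "(\<Sum>\<alpha> | length \<alpha> = Suc k. f \<alpha>) = (\<Sum>\<alpha> | length \<alpha> = k. \<Sum>i\<in>UNIV. f (\<alpha> @ [i]))"
proof -
  have "bij_betw (\<lambda>(\<alpha>, i). \<alpha> @ [i]) ({\<alpha>. length \<alpha> = k} \<times> (UNIV :: 'n set)) {\<alpha>. length \<alpha> = Suc k}"
    by (rule bij_betwI[of _ _ _ "\<lambda>\<alpha>. (butlast \<alpha>, last \<alpha>)"])
       (auto simp flip: length_greater_0_conv)
  then show ?thesis
    by (simp add: sum.cartesian_product sum.reindex_bij_betw[symmetric] case_prod_beta')
qed

lemma sum_words_le_Suc: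
  fixes f :: "'n::finite list \<Rightarrow> 'a::comm_monoid_add"
  shows "(\<Sum>\<alpha> | length \<alpha> \<le> Suc k. f \<alpha>) = (\<Sum>\<alpha> | length \<alpha> \<le> k. f \<alpha>) + (\<Sum>\<alpha> | length \<alpha> = Suc k. f \<alpha>)"
proof -
  have "{\<alpha> :: 'n list. length \<alpha> \<le> Suc k} = {\<alpha>. length \<alpha> \<le> k} \<union> {\<alpha>. length \<alpha> = Suc k}"
    by auto
  then show ?thesis by (simp add: sum.union_disjoint disjoint_iff)
qed

lemma sum_words_le:
  fixes f :: "'n::finite list \<Rightarrow> 'a::comm_monoid_add"
  shows "(\<Sum>\<alpha> | length \<alpha> \<le> n. f \<alpha>) = (\<Sum>k\<le>n. \<Sum>\<alpha> | length \<alpha> = k. f \<alpha>)"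
  by (induction n) (simp_all add: sum_words_le_Suc)

lemma word_op_bounded_ops: "(\<And>i. X i \<in> bounded_ops) \<Longrightarrow> word_op X \<alpha> \<in> bounded_ops"
  by (induction \<alpha>) (auto intro: id_bounded_ops compose_bounded_ops)

lemma word_op_append: "word_op X (\<alpha> @ \<beta>) = word_op X \<alpha> o\<^sub>L word_op X \<beta>"
  by (induction \<alpha>) (auto simp: blinfun_eqI)

lemma word_op_scaleR: "word_op (\<lambda>i. r *\<^sub>R X i) \<alpha> = r ^ length \<alpha> *\<^sub>R word_op X \<alpha>"
  by (induction \<alpha>) (auto intro!: blinfun_eqI simp: blinfun.bilinear_simps)

lemma adj_word_op_append:
  assumes "\<And>i. X i \<in> bounded_ops"
  shows "adj (word_op X (\<alpha> @ \<beta>)) x = adj (word_op X \<beta>) (adj (word_op X \<alpha>) x)"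
  by (simp add: word_op_append adj_compose word_op_bounded_ops assms)

lemma sum_norm_adj_eq:
  assumes "\<And>i. X i \<in> bounded_ops"
  shows "(\<Sum>i\<in>UNIV. (norm (adj (X i) x))\<^sup>2) = inner ((\<Sum>i\<in>UNIV. X i o\<^sub>L adj (X i)) x) x"
  by (simp add: blinfun_apply_sum cinner_sum_left power2_norm_eq_inner Re_cinner[symmetric]
      cinner_adj[OF assms])

lemma row_norm_nonneg: "0 \<le> row_norm X"
  by (simp add: row_norm_def)

lemma sum_norm_adj_le:
  assumes "\<And>i. X i \<in> bounded_ops"
  shows "(\<Sum>i\<in>UNIV. (norm (adj (X i) x))\<^sup>2) \<le> (row_norm X * norm x)\<^sup>2"
proof -
  let ?S = "\<Sum>i\<in>UNIV. X i o\<^sub>L adj (X i)"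
  have "inner (?S x) x \<le> norm ?S * norm x * norm x"
    by (meson norm_blinfun norm_cauchy_schwarz mult_right_mono norm_ge_zero order_trans)
  also have "\<dots> = norm ?S * (norm x)\<^sup>2" by (simp add: power2_eq_square)
  finally show ?thesis
    unfolding sum_norm_adj_eq[OF assms] row_norm_def by (simp add: power_mult_distrib)
qed

lemma row_norm_scaleR:
  assumes "\<And>i. X i \<in> bounded_ops"
  shows "row_norm (\<lambda>i. r *\<^sub>R X i) = \<bar>r\<bar> * row_norm X"
proof -
  have "(\<Sum>i\<in>UNIV. r *\<^sub>R X i o\<^sub>L adj (r *\<^sub>R X i)) = r\<^sup>2 *\<^sub>R (\<Sum>i\<in>UNIV. X i o\<^sub>L adj (X i))"
    unfolding scaleR_sum_right
    by (intro sum.cong refl blinfun_eqI)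
       (simp add: adj_scaleR[OF assms] blinfun.bilinear_simps power2_eq_square)
  then show ?thesis by (simp add: row_norm_def real_sqrt_mult)
qed

text \<open>Each further letter costs a factor \<open>(row_norm X)\<^sup>2\<close>, by the
  one-letter estimate at the vectors \<open>adj (word_op X \<alpha>) x\<close>.\<close>

lemma sum_norm_adj_word_le:
  assumes X: "\<And>i. X i \<in> bounded_ops"
  shows "(\<Sum>\<alpha> | length \<alpha> = k. (norm (adj (word_op X \<alpha>) x))\<^sup>2) \<le> (row_norm X ^ k * norm x)\<^sup>2"
proof (induction k)
  case 0
  then show ?case by (simp add: adj_id)
next
  case (Suc k)
  have "(\<Sum>\<alpha> | length \<alpha> = Suc k. (norm (adj (word_op X \<alpha>) x))\<^sup>2)
      = (\<Sum>\<alpha> | length \<alpha> = k. \<Sum>i\<in>UNIV. (norm (adj (X i) (adj (word_op X \<alpha>) x)))\<^sup>2)"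
    unfolding sum_words_Suc adj_word_op_append[OF X] by (simp add: adj_compose adj_id X id_bounded_ops)
  also have "\<dots> \<le> (\<Sum>\<alpha> | length \<alpha> = k. (row_norm X * norm (adj (word_op X \<alpha>) x))\<^sup>2)"
    by (intro sum_mono sum_norm_adj_le X)
  also have "\<dots> = (row_norm X)\<^sup>2 * (\<Sum>\<alpha> | length \<alpha> = k. (norm (adj (word_op X \<alpha>) x))\<^sup>2)"
    by (simp add: power_mult_distrib sum_distrib_left)
  also have "\<dots> \<le> (row_norm X)\<^sup>2 * (row_norm X ^ k * norm x)\<^sup>2"
    by (intro mult_left_mono Suc.IH) simp
  finally show ?case by (simp add: power_mult_distrib mult_ac)
qed

text \<open>Truncation by degree keeps the matrix argument finite; on strict row contractions
  \<open>func_calc\<close> is the limit of these polynomials.\<close>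

definition poly_calc :: "'n::finite nc_series \<Rightarrow> nat \<Rightarrow> ('n \<Rightarrow> 'h::chilbert_space \<Rightarrow>\<^sub>L 'h) \<Rightarrow> ('h \<Rightarrow>\<^sub>L 'h)" where
  "poly_calc c n X = (\<Sum>\<alpha> | length \<alpha> \<le> n. scaleC_op (c \<alpha>) (word_op X \<alpha>))"

lemma poly_calc_bounded_ops:
  assumes "\<And>i. X i \<in> bounded_ops"
  shows "poly_calc c n X \<in> bounded_ops"
  unfolding poly_calc_def by (intro sum_bounded_ops scaleC_op_bounded_ops word_op_bounded_ops assms)

lemma adj_poly_calc:
  assumes "\<And>i. X i \<in> bounded_ops"
  shows "adj (poly_calc c n X) x = (\<Sum>\<alpha> | length \<alpha> \<le> n. cnj (c \<alpha>) *\<^sub>C adj (word_op X \<alpha>) x)"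
  unfolding poly_calc_def
  by (subst adj_sum_scaleC)
     (auto simp: word_op_bounded_ops assms blinfun_apply_sum scaleC_op.rep_eq)

text \<open>Passing to the adjoint makes the row condition applicable; Cauchy--Schwarz over the
  words then avoids any factor counting them.\<close>

lemma norm_homogeneous_le:
  fixes X :: "'n::finite \<Rightarrow> 'h::chilbert_space \<Rightarrow>\<^sub>L 'h"
  assumes X: "\<And>i. X i \<in> bounded_ops"
  shows "norm (\<Sum>\<alpha> | length \<alpha> = k. scaleC_op (c \<alpha>) (word_op X \<alpha>))
    \<le> L2_set (\<lambda>\<alpha>. cmod (c \<alpha>)) {\<alpha>. length \<alpha> = k} * row_norm X ^ k" (is "norm ?P \<le> ?L * _")
proof -
  have "?P \<in> bounded_ops"
    by (intro sum_bounded_ops scaleC_op_bounded_ops word_op_bounded_ops X)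
  then have "norm ?P = norm (adj ?P)" by (rule norm_adj[symmetric])
  also have "\<dots> \<le> ?L * row_norm X ^ k"
  proof (rule norm_blinfun_bound)
    show "0 \<le> ?L * row_norm X ^ k" by (simp add: row_norm_nonneg)
    fix x
    have "adj ?P x = (\<Sum>\<alpha> | length \<alpha> = k. cnj (c \<alpha>) *\<^sub>C adj (word_op X \<alpha>) x)"
      by (subst adj_sum_scaleC) (auto simp: word_op_bounded_ops X blinfun_apply_sum scaleC_op.rep_eq)
    also have "norm \<dots> \<le> (\<Sum>\<alpha> | length \<alpha> = k. \<bar>cmod (c \<alpha>)\<bar> * \<bar>norm (adj (word_op X \<alpha>) x)\<bar>)"
      by (rule order_trans[OF norm_sum]) (simp add: norm_scaleC)
    also have "\<dots> \<le> ?L * L2_set (\<lambda>\<alpha>. norm (adj (word_op X \<alpha>) x)) {\<alpha>. length \<alpha> = k}"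
      by (rule L2_set_mult_ineq)
    also have "\<dots> \<le> ?L * (row_norm X ^ k * norm x)"
    proof (rule mult_left_mono)
      show "L2_set (\<lambda>\<alpha>. norm (adj (word_op X \<alpha>) x)) {\<alpha>. length \<alpha> = k} \<le> row_norm X ^ k * norm x"
        unfolding L2_set_def
        by (rule real_le_lsqrt) (simp_all add: sum_nonneg row_norm_nonneg sum_norm_adj_word_le X)
    qed simp
    finally show "norm (adj ?P x) \<le> ?L * row_norm X ^ k * norm x" by (simp add: mult_ac)
  qed
  finally show ?thesis .
qed


section \<open>The creation operators\<close>

lift_definition ell2_unit :: "'a \<Rightarrow> 'a ell2" is "\<lambda>b a. of_bool (a = b)"
  subgoal for b
    by (rule finite_nonzero_values_imp_summable_on, rule finite_subset[of _ "{b}"]) auto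
  done

lemma cinner_unit: "cinner x (ell2_unit a) = ell2_coord x a"
proof -
  have "cinner x (ell2_unit a) = (\<Sum>\<^sub>\<infinity>i\<in>{a}. ell2_coord x i * cnj (of_bool (i = a)))"
    unfolding cinner_ell2_def ell2_cinner_def ell2_unit.rep_eq by (rule infsum_cong_neutral) auto
  then show ?thesis by simp
qed

lemma ell2_coord_sum: "ell2_coord (\<Sum>i\<in>I. f i) a = (\<Sum>i\<in>I. ell2_coord (f i) a)"
  by (simp add: cinner_unit[symmetric] cinner_sum_left)

lemma norm_sum_unit:
  assumes "finite G"
  shows "(norm (\<Sum>\<gamma>\<in>G. \<xi> \<gamma> *\<^sub>C ell2_unit \<gamma>))\<^sup>2 = (\<Sum>\<gamma>\<in>G. (cmod (\<xi> \<gamma>))\<^sup>2)"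
proof -
  have *: "ell2_coord (\<Sum>\<gamma>\<in>G. \<xi> \<gamma> *\<^sub>C ell2_unit \<gamma>) a = (if a \<in> G then \<xi> a else 0)" for a
    using assms by (simp add: ell2_coord_sum scaleC_ell2.rep_eq ell2_unit.rep_eq of_bool_def if_distrib cong: if_cong)
  have "(norm (\<Sum>\<gamma>\<in>G. \<xi> \<gamma> *\<^sub>C ell2_unit \<gamma>))\<^sup>2 = (\<Sum>\<^sub>\<infinity>a\<in>G. (cmod (\<xi> a))\<^sup>2)"
    unfolding norm_ell2_sq * by (rule infsum_cong_neutral) auto
  then show ?thesis using assms by simp
qed

lemma creation_apply: "creation i x = creation_vec i x"
  by (simp add: creation.rep_eq)

lemma creation_bounded_ops: "creation i \<in> bounded_ops"
  unfolding bounded_ops_def creation_apply mem_Collect_eq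
  by (intro allI, transfer) (auto simp: creation_coord_def fun_eq_iff split: list.split)

lemma creation_unit: "creation i (ell2_unit \<beta>) = ell2_unit (i # \<beta>)"
  unfolding creation_apply
  by transfer (auto simp: creation_coord_def fun_eq_iff split: list.split)

lemma word_op_creation_unit: "word_op creation \<alpha> (ell2_unit \<beta>) = ell2_unit (\<alpha> @ \<beta>)"
  by (induction \<alpha>) (auto simp: creation_unit)

lemma norm_creation: "norm (creation i x) = norm x"
proof -
  have "(norm (creation i x))\<^sup>2 = (norm x)\<^sup>2"
    unfolding norm_ell2_sq creation_apply creation_vec.rep_eq
    by (rule infsumI creation_coord_sq_has_sum ell2_coord_summable)+
  then show ?thesis by simp
qed

lemma inner_creation: "i \<noteq> j \<Longrightarrow> inner (creation i x) (creation j y) = 0"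
  unfolding inner_ell2_def ell2_cinner_def creation_apply creation_vec.rep_eq
  by (subst infsum_0) (auto simp: creation_coord_def split: list.split)

lemma norm_sum_creation:
  "(norm (\<Sum>i\<in>UNIV. creation i (y i)))\<^sup>2 = (\<Sum>i\<in>UNIV. (norm (y i))\<^sup>2)" for y :: "'n::finite \<Rightarrow> 'n fock"
proof -
  have "(norm (\<Sum>i\<in>UNIV. creation i (y i)))\<^sup>2 = (\<Sum>i\<in>UNIV. \<Sum>j\<in>UNIV. inner (creation i (y i)) (creation j (y j)))"
    unfolding power2_norm_eq_inner by (subst inner_sum_left) (simp only: inner_sum_right)
  also have "\<dots> = (\<Sum>i\<in>UNIV. \<Sum>j\<in>UNIV. if j = i then inner (creation i (y i)) (creation i (y i)) else 0)"
    by (intro sum.cong refl) (auto simp: inner_creation)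
  also have "\<dots> = (\<Sum>i\<in>UNIV. (norm (y i))\<^sup>2)"
    by (simp add: power2_norm_eq_inner[symmetric] norm_creation)
  finally show ?thesis .
qed

text \<open>The creation operators are isometries with orthogonal ranges, so the square of the norm
  of \<open>?S x\<close> equals \<open>inner (?S x) x\<close>, and Cauchy--Schwarz finishes.\<close>

lemma row_norm_creation_le: "row_norm (creation :: 'n::finite \<Rightarrow> _) \<le> 1"
proof -
  let ?S = "\<Sum>i\<in>UNIV. creation i o\<^sub>L adj (creation (i :: 'n))"
  have "norm ?S \<le> 1"
  proof (rule norm_blinfun_bound)
    fix x :: "'n fock"
    have "(norm (?S x))\<^sup>2 = inner (?S x) x"
      unfolding sum_norm_adj_eq[OF creation_bounded_ops, symmetric]
      by (simp add: blinfun_apply_sum norm_sum_creation)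
    also have "\<dots> \<le> norm (?S x) * norm x" by (rule norm_cauchy_schwarz)
    finally have "norm (?S x) * norm (?S x) \<le> norm (?S x) * norm x"
      by (simp add: power2_eq_square)
    then show "norm (?S x) \<le> 1 * norm x"
      by (cases "?S x = 0") (auto simp: mult_le_cancel_left_pos)
  qed simp
  then show ?thesis by (simp add: row_norm_def)
qed

text \<open>The inner sums form a finite corner of the matrix of the adjoint of
  \<open>poly_calc c n creation\<close>, since word operators prepend words. The shape is that of
  the scalar hypothesis in \<open>psd_form_matrix_bound\<close>.\<close>

lemma scalar_poly_bound:
  fixes c :: "'n::finite nc_series"
  shows "(\<Sum>\<beta> | length \<beta> \<le> M. (cmod (\<Sum>\<alpha> | length \<alpha> \<le> n. cnj (c \<alpha>) * \<xi> (\<alpha> @ \<beta>)))\<^sup>2)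
    \<le> (norm (poly_calc c n creation))\<^sup>2 * (\<Sum>\<gamma> | length \<gamma> \<le> n + M. (cmod (\<xi> \<gamma>))\<^sup>2)"
proof -
  let ?G = "{\<gamma> :: 'n list. length \<gamma> \<le> n + M}"
  let ?Q = "poly_calc c n creation"
  \<comment> \<open>The cutoff \<open>n + M\<close> admits every \<open>\<alpha> @ \<beta>\<close>
    that occurs, so this finite vector carries all relevant values of \<open>\<xi>\<close>.\<close>
  define x where "x = (\<Sum>\<gamma>\<in>?G. \<xi> \<gamma> *\<^sub>C ell2_unit \<gamma>)"
  have Q: "?Q \<in> bounded_ops" by (intro poly_calc_bounded_ops creation_bounded_ops)
  have x: "ell2_coord x \<gamma> = \<xi> \<gamma>" if "\<gamma> \<in> ?G" for \<gamma>
    using that by (simp add: x_def ell2_coord_sum scaleC_ell2.rep_eq ell2_unit.rep_eq of_bool_def if_distrib cong: if_cong)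
  have "ell2_coord (adj ?Q x) \<beta> = (\<Sum>\<alpha> | length \<alpha> \<le> n. cnj (c \<alpha>) * \<xi> (\<alpha> @ \<beta>))" if "length \<beta> \<le> M" for \<beta>
  proof -
    have "ell2_coord (adj ?Q x) \<beta> = cinner x (?Q (ell2_unit \<beta>))"
      unfolding cinner_unit[symmetric] by (rule cinner_adj_left[OF Q])
    also have "\<dots> = (\<Sum>\<alpha> | length \<alpha> \<le> n. cnj (c \<alpha>) * ell2_coord x (\<alpha> @ \<beta>))"
      by (simp add: poly_calc_def blinfun_apply_sum scaleC_op.rep_eq word_op_creation_unit
          cinner_sum_right cinner_scaleC_right cinner_unit)
    also have "\<dots> = (\<Sum>\<alpha> | length \<alpha> \<le> n. cnj (c \<alpha>) * \<xi> (\<alpha> @ \<beta>))"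
      using that by (intro sum.cong refl) (simp add: x)
    finally show ?thesis .
  qed
  then have "(\<Sum>\<beta> | length \<beta> \<le> M. (cmod (\<Sum>\<alpha> | length \<alpha> \<le> n. cnj (c \<alpha>) * \<xi> (\<alpha> @ \<beta>)))\<^sup>2)
      = (\<Sum>\<beta> | length \<beta> \<le> M. (cmod (ell2_coord (adj ?Q x) \<beta>))\<^sup>2)"
    by (intro sum.cong) auto
  also have "\<dots> \<le> (norm (adj ?Q x))\<^sup>2" by (rule sum_coord_le_norm_ell2) simp
  also have "\<dots> \<le> (norm ?Q * norm x)\<^sup>2"
    using norm_blinfun[of "adj ?Q" x] by (intro power_mono) (simp_all add: norm_adj[OF Q])
  also have "\<dots> = (norm ?Q)\<^sup>2 * (\<Sum>\<gamma>\<in>?G. (cmod (\<xi> \<gamma>))\<^sup>2)"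
    by (simp add: power_mult_distrib x_def norm_sum_unit)
  finally show ?thesis .
qed


section \<open>The noncommutative von Neumann inequality\<close>

definition defect_form :: "('n::finite \<Rightarrow> 'h::chilbert_space \<Rightarrow>\<^sub>L 'h) \<Rightarrow> 'h \<Rightarrow> 'h \<Rightarrow> complex" where
  "defect_form X x y = cinner x y - (\<Sum>i\<in>UNIV. cinner (adj (X i) x) (adj (X i) y))"

lemma Re_defect_form: "Re (defect_form X x x) = (norm x)\<^sup>2 - (\<Sum>i\<in>UNIV. (norm (adj (X i) x))\<^sup>2)"
  by (simp add: defect_form_def Re_cinner power2_norm_eq_inner)

lemma psd_defect_form:
  fixes X :: "'n::finite \<Rightarrow> 'h::chilbert_space \<Rightarrow>\<^sub>L 'h"
  assumes X: "\<And>i. X i \<in> bounded_ops" and "row_norm X \<le> 1"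
  shows "psd_form (defect_form X)"
proof
  fix x y z :: 'h and c
  show "defect_form X (x + y) z = defect_form X x z + defect_form X y z"
    by (simp add: defect_form_def cinner_add_left blinfun.add_right sum.distrib)
  show "defect_form X (c *\<^sub>C x) y = c * defect_form X x y"
    by (simp add: defect_form_def cinner_scaleC_left bounded_opsD adj_bounded_ops X
        sum_distrib_left right_diff_distrib)
  show "defect_form X x y = cnj (defect_form X y x)"
    by (simp add: defect_form_def cinner_commute[symmetric])
  have "(row_norm X * norm x)\<^sup>2 \<le> (norm x)\<^sup>2"
    using assms(2) by (intro power_mono) (auto simp: row_norm_nonneg mult_left_le_one_le)
  then show "0 \<le> Re (defect_form X x x)"
    unfolding Re_defect_form using order_trans[OF sum_norm_adj_le[OF X]] by simp
qed

text \<open>The sum telescopes, as each defect compares words of length \<open>k\<close> with those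
  of length \<open>k + 1\<close>. The subtracted term measures how far the truncated Poisson kernel
  is from isometric.\<close>

lemma sum_defect_form:
  assumes X: "\<And>i. X i \<in> bounded_ops"
  shows "(\<Sum>\<beta> | length \<beta> \<le> M. Re (defect_form X (adj (word_op X \<beta>) x) (adj (word_op X \<beta>) x)))
    = (norm x)\<^sup>2 - (\<Sum>\<beta> | length \<beta> = Suc M. (norm (adj (word_op X \<beta>) x))\<^sup>2)"
proof (induction M)
  case 0
  show ?case
    by (simp add: Re_defect_form sum_words_Suc adj_id adj_compose X id_bounded_ops)
next
  case (Suc M)
  have "(\<Sum>\<beta> | length \<beta> = Suc (Suc M). (norm (adj (word_op X \<beta>) x))\<^sup>2)
      = (\<Sum>\<beta> | length \<beta> = Suc M. \<Sum>i\<in>UNIV. (norm (adj (X i) (adj (word_op X \<beta>) x)))\<^sup>2)"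
    unfolding sum_words_Suc[of _ "Suc M"] adj_word_op_append[OF X]
    by (simp add: adj_compose adj_id X id_bounded_ops)
  then show ?case
    unfolding sum_words_le_Suc Suc.IH by (simp add: Re_defect_form sum_subtractf)
qed

text \<open>
  With \<open>K\<close> the Poisson kernel, \<open>K k = (\<Delta> X\<^sub>\<beta>\<^sup>* k)\<^sub>\<beta>\<close> where \<open>\<Delta>\<^sup>2 = I - \<Sum>X\<^sub>iX\<^sub>i\<^sup>*\<close>, one has
  \<open>K q(X)\<^sup>* = (q(S)\<^sup>* \<otimes> I) K\<close>. The defect form replaces \<open>\<Delta>\<close>, and truncating to words of length at
  most \<open>M\<close> makes all sums finite.
\<close>

lemma von_neumann_poly:
  assumes X: "\<And>i. X i \<in> bounded_ops" and lt: "row_norm X < 1"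
  shows "norm (poly_calc c n X) \<le> norm (poly_calc c n creation)"
proof -
  let ?C = "norm (poly_calc c n creation)"
  let ?B = "\<lambda>x. Re (defect_form X x x)"
  have Q: "poly_calc c n X \<in> bounded_ops" by (rule poly_calc_bounded_ops[OF X])
  have "norm (adj (poly_calc c n X)) \<le> ?C"
  proof (rule norm_blinfun_bound)
    fix k
    define y where "y = adj (poly_calc c n X) k"
    \<comment> \<open>The intertwining relation of the Poisson kernel, in coordinates.\<close>
    have y: "adj (word_op X \<beta>) y = (\<Sum>\<alpha> | length \<alpha> \<le> n. cnj (c \<alpha>) *\<^sub>C adj (word_op X (\<alpha> @ \<beta>)) k)" for \<beta>
      by (simp add: y_def adj_poly_calc X adj_word_op_append blinfun.sum_right bounded_opsD
          adj_bounded_ops word_op_bounded_ops)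
    \<comment> \<open>The tail at \<open>y\<close> is bounded through
      \<open>row_norm X ^ Suc M\<close> and vanishes in the limit; the tail at \<open>k\<close> is
      dropped because of its sign.\<close>
    have "(norm y)\<^sup>2 - (row_norm X ^ Suc M * norm y)\<^sup>2 \<le> ?C\<^sup>2 * (norm k)\<^sup>2" for M
    proof -
      have "(norm y)\<^sup>2 - (row_norm X ^ Suc M * norm y)\<^sup>2 \<le> (\<Sum>\<beta> | length \<beta> \<le> M. ?B (adj (word_op X \<beta>) y))"
        unfolding sum_defect_form[OF X] using sum_norm_adj_word_le[OF X, where x = y and k = "Suc M"] by simp
      also have "\<dots> \<le> ?C\<^sup>2 * (\<Sum>\<gamma> | length \<gamma> \<le> n + M. ?B (adj (word_op X \<gamma>) k))"
        unfolding y using lt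
        by (intro psd_form_matrix_bound[where w = "\<lambda>\<gamma>. adj (word_op X \<gamma>) k"] scalar_poly_bound
            psd_defect_form X) auto
      also have "\<dots> \<le> ?C\<^sup>2 * (norm k)\<^sup>2"
        unfolding sum_defect_form[OF X] by (intro mult_left_mono) (auto intro: sum_nonneg)
      finally show ?thesis .
    qed
    moreover have "(\<lambda>M. (norm y)\<^sup>2 - (row_norm X ^ Suc M * norm y)\<^sup>2) \<longlonglongrightarrow> (norm y)\<^sup>2 - (0 * norm y)\<^sup>2"
      using lt by (intro tendsto_intros LIMSEQ_Suc LIMSEQ_power_zero) (simp add: row_norm_nonneg)
    ultimately have "(norm y)\<^sup>2 \<le> (?C * norm k)\<^sup>2"
      by (intro LIMSEQ_le_const2[of _ "(norm y)\<^sup>2"]) (auto simp: power_mult_distrib)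
    then show "norm (adj (poly_calc c n X) k) \<le> ?C * norm k"
      unfolding y_def by (rule power2_le_imp_le) simp
  qed simp
  then show ?thesis by (simp add: norm_adj[OF Q])
qed


section \<open>Convergence of the functional calculus\<close>

definition coeff_norm :: "'n::finite nc_series \<Rightarrow> nat \<Rightarrow> real" where
  "coeff_norm a k = L2_set (\<lambda>\<alpha>. cmod (a \<alpha>)) {\<alpha>. length \<alpha> = k}"

text \<open>The square root inside \<open>coeff_norm\<close> accounts for the 2 in the exponent
  \<open>1 / (2 * real k)\<close>; the \<open>conv_radius\<close> form opens the theory of scalar
  power series.\<close>

lemma Hol_iff: "a \<in> Hol \<longleftrightarrow> 1 \<le> conv_radius (coeff_norm a)"
proof -
  let ?l = "limsup (\<lambda>k. ereal (root k (norm (coeff_norm a k))))"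
  \<comment> \<open>At \<open>k = 0\<close> both sides are default values and may differ, which the
    limsup does not see.\<close>
  have "root k (norm (coeff_norm a k)) = (\<Sum>\<alpha> | length \<alpha> = k. (cmod (a \<alpha>))\<^sup>2) powr (1 / (2 * real k))"
    if "k > 0" for k
  proof -
    define S where "S = (\<Sum>\<alpha> | length \<alpha> = k. (cmod (a \<alpha>))\<^sup>2)"
    have "0 \<le> S" unfolding S_def by (intro sum_nonneg) simp
    then have "root k (sqrt S) = S powr (1 / (2 * real k))"
      using that by (cases "S = 0") (auto simp: root_powr_inverse powr_half_sqrt[symmetric] powr_powr)
    then show ?thesis
      using \<open>0 \<le> S\<close> by (simp add: coeff_norm_def L2_set_def S_def)
  qed
  then have "?l = limsup (\<lambda>k. ereal ((\<Sum>\<alpha> | length \<alpha> = k. (cmod (a \<alpha>))\<^sup>2) powr (1 / (2 * real k))))"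
    by (intro Limsup_eq eventually_mono[OF eventually_gt_at_top[of 0]]) simp
  then have "a \<in> Hol \<longleftrightarrow> ?l \<le> 1"
    by (simp add: Hol_def)
  also have "\<dots> \<longleftrightarrow> 1 \<le> inverse ?l"
  proof -
    have "0 \<le> ?l"
      by (intro le_Limsup always_eventually) (simp_all add: real_root_ge_zero)
    then show ?thesis
      by (cases ?l) (auto simp: one_ereal_def field_simps)
  qed
  finally show ?thesis by (simp add: conv_radius_def)
qed

lemma Hol_diff:
  assumes "f \<in> Hol" "g \<in> Hol"
  shows "g - f \<in> Hol"
proof -
  have le: "coeff_norm (g - f) k \<le> coeff_norm g k + coeff_norm f k" for k
  proof -
    have "coeff_norm (g - f) k \<le> L2_set (\<lambda>\<alpha>. cmod (g \<alpha>) + cmod (f \<alpha>)) {\<alpha>. length \<alpha> = k}"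
      unfolding coeff_norm_def by (intro L2_set_mono) (auto intro: norm_triangle_ineq4)
    also have "\<dots> \<le> coeff_norm g k + coeff_norm f k"
      unfolding coeff_norm_def by (rule L2_set_triangle_ineq)
    finally show ?thesis .
  qed
  have "1 \<le> conv_radius (coeff_norm (g - f))"
  proof (rule conv_radius_geI_ex)
    fix r :: real assume r: "0 < r" "ereal r < 1"
    have "ereal r < conv_radius (coeff_norm g)" "ereal r < conv_radius (coeff_norm f)"
      using assms r(2) unfolding Hol_iff by (meson less_le_trans)+
    then have "summable (\<lambda>k. coeff_norm g k * r ^ k + coeff_norm f k * r ^ k)"
      using r(1) by (intro summable_add summable_in_conv_radius) simp_all
    then have "summable (\<lambda>k. coeff_norm (g - f) k * r ^ k)"
    proof (rule summable_comparison_test'[where N = 0])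
      fix k
      show "norm (coeff_norm (g - f) k * r ^ k) \<le> coeff_norm g k * r ^ k + coeff_norm f k * r ^ k"
        using mult_right_mono[OF le, of "r ^ k" k] r
        by (simp add: coeff_norm_def ring_distribs)
    qed
    then show "\<exists>z. norm z = r \<and> summable (\<lambda>k. coeff_norm (g - f) k * z ^ k)"
      using r by (intro exI[of _ r]) simp
  qed
  then show ?thesis by (simp add: Hol_iff)
qed

text \<open>The homogeneous parts are dominated by the scalar series with coefficients
  \<open>coeff_norm a\<close> at \<open>row_norm X\<close>, a point inside its disc of
  convergence.\<close>

lemma poly_calc_LIMSEQ:
  assumes X: "\<And>i. X i \<in> bounded_ops" and lt: "row_norm X < 1" and a: "a \<in> Hol"
  shows "(\<lambda>n. poly_calc a n X) \<longlonglongrightarrow> func_calc a X"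
proof -
  have "ereal (norm (row_norm X)) < conv_radius (coeff_norm a)"
    using a lt row_norm_nonneg[of X] unfolding Hol_iff
    by (metis abs_of_nonneg ereal_less(3) less_le_trans real_norm_def)
  then have "summable (\<lambda>k. coeff_norm a k * row_norm X ^ k)"
    by (rule summable_in_conv_radius)
  then have "summable (\<lambda>k. \<Sum>\<alpha> | length \<alpha> = k. scaleC_op (a \<alpha>) (word_op X \<alpha>))"
    by (rule summable_comparison_test'[where N = 0])
       (use norm_homogeneous_le[OF X] in \<open>simp add: coeff_norm_def\<close>)
  then show ?thesis
    unfolding poly_calc_def func_calc_def sum_words_le by (rule summable_LIMSEQ')
qed

lemma func_calc_bounded_ops:
  assumes "\<And>i. X i \<in> bounded_ops" "row_norm X < 1" "a \<in> Hol"
  shows "func_calc a X \<in> bounded_ops"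
  by (rule closed_sequentially[OF closed_bounded_ops _ poly_calc_LIMSEQ[OF assms]])
     (rule poly_calc_bounded_ops[OF assms(1)])

lemma scaleC_op_diff: "scaleC_op (c - d) A = scaleC_op c A - scaleC_op d A"
proof (rule blinfun_eqI)
  fix x
  show "scaleC_op (c - d) A x = (scaleC_op c A - scaleC_op d A) x"
    using scaleC_add_left[of "c - d" d "A x"]
    by (simp add: scaleC_op.rep_eq blinfun.diff_left eq_diff_eq)
qed

lemma scaleC_op_scaleR: "scaleC_op c (r *\<^sub>R A) = r *\<^sub>R scaleC_op c A"
  by (rule blinfun_eqI)
     (simp add: scaleC_op.rep_eq blinfun.scaleR_left scaleC_of_real[symmetric] scaleC_scaleC mult.commute)

lemma scaleR_scaleC_op: "r *\<^sub>R scaleC_op c A = scaleC_op (of_real r * c) A"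
  by (rule blinfun_eqI)
     (simp add: scaleC_op.rep_eq blinfun.scaleR_left scaleC_of_real[symmetric] scaleC_scaleC)

lemma func_calc_diff:
  assumes "\<And>i. X i \<in> bounded_ops" "row_norm X < 1" "f \<in> Hol" "g \<in> Hol"
  shows "func_calc (g - f) X = func_calc g X - func_calc f X"
proof (rule LIMSEQ_unique)
  show "(\<lambda>n. poly_calc (g - f) n X) \<longlonglongrightarrow> func_calc (g - f) X"
    by (intro poly_calc_LIMSEQ Hol_diff assms)
  have "poly_calc (g - f) n X = poly_calc g n X - poly_calc f n X" for n
    by (simp add: poly_calc_def scaleC_op_diff sum_subtractf)
  then show "(\<lambda>n. poly_calc (g - f) n X) \<longlonglongrightarrow> func_calc g X - func_calc f X"
    using assms by (simp add: tendsto_diff poly_calc_LIMSEQ)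
qed

text \<open>Absorbing the dilation into the coefficients lets one polynomial inequality serve both
  dilated tuples.\<close>

lemma poly_calc_scaleR:
  "poly_calc a n (\<lambda>i. r *\<^sub>R X i) = poly_calc (\<lambda>\<alpha>. of_real (r ^ length \<alpha>) * a \<alpha>) n X"
  by (simp add: poly_calc_def word_op_scaleR scaleC_op_scaleR scaleR_scaleC_op del: of_real_power)

lemma row_norm_scaled_creation_less:
  assumes "0 \<le> r" "r < 1"
  shows "row_norm (\<lambda>i :: 'n::finite. r *\<^sub>R creation i) < 1"
proof -
  have "r * row_norm (creation :: 'n \<Rightarrow> _) \<le> r"
    using mult_left_mono[OF row_norm_creation_le \<open>0 \<le> r\<close>] by simp
  then show ?thesis using assms by (simp add: row_norm_scaleR creation_bounded_ops)
qed

lemma radial_LIMSEQ: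
  assumes "f \<in> Hol" "0 \<le> r" "r < 1"
  shows "(\<lambda>n. poly_calc f n (\<lambda>i. r *\<^sub>R creation i)) \<longlonglongrightarrow> func_calc f (\<lambda>i. r *\<^sub>R creation i)"
  using assms
  by (intro poly_calc_LIMSEQ scaleR_bounded_ops creation_bounded_ops row_norm_scaled_creation_less)

text \<open>Writing \<open>X\<close> as the dilation by \<open>r\<close> of \<open>Y\<close>, the
  strict \<open>row_norm X < r\<close> makes \<open>Y\<close> a strict row contraction, so
  \<open>von_neumann_poly\<close> applies to the dilated truncations; \<open>r < 1\<close> lets the
  creation side converge.\<close>

lemma von_neumann_radial:
  fixes X :: "'n::finite \<Rightarrow> 'h::chilbert_space \<Rightarrow>\<^sub>L 'h"
  assumes X: "\<And>i. X i \<in> bounded_ops" and f: "f \<in> Hol" and r: "row_norm X < r" "r < 1"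
  shows "norm (func_calc f X) \<le> radial_norm f r"
proof (rule LIMSEQ_le)
  have r0: "0 < r" using r row_norm_nonneg[of X] by simp
  show "(\<lambda>n. norm (poly_calc f n X)) \<longlonglongrightarrow> norm (func_calc f X)"
    using r by (intro tendsto_norm poly_calc_LIMSEQ X f) simp
  show "(\<lambda>n. norm (poly_calc f n (\<lambda>i. r *\<^sub>R creation i))) \<longlonglongrightarrow> radial_norm f r"
    unfolding radial_norm_def using r r0 by (intro tendsto_norm radial_LIMSEQ f) auto
  define Y where "Y = (\<lambda>i. inverse r *\<^sub>R X i)"
  have XY: "X = (\<lambda>i. r *\<^sub>R Y i)" using r0 by (simp add: Y_def)
  have Y: "Y i \<in> bounded_ops" for i unfolding Y_def by (intro scaleR_bounded_ops X)
  have "row_norm Y < 1"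
    unfolding Y_def using r r0 by (simp add: row_norm_scaleR X field_simps)
  then have "norm (poly_calc f n X) \<le> norm (poly_calc f n (\<lambda>i. r *\<^sub>R creation i))" for n
    unfolding XY poly_calc_scaleR by (intro von_neumann_poly Y)
  then show "\<exists>N. \<forall>n\<ge>N. norm (poly_calc f n X) \<le> norm (poly_calc f n (\<lambda>i. r *\<^sub>R creation i))"
    by blast
qed


section \<open>Radial integrals\<close>

lemma radial_norm_nonneg: "0 \<le> radial_norm f r"
  by (simp add: radial_norm_def)

lemma radial_norm_measurable:
  assumes f: "f \<in> Hol"
  shows "set_borel_measurable lebesgue {0..1} (radial_norm f)"
proof -
  let ?g = "\<lambda>n r. indicator {0..<1} r *\<^sub>R norm (poly_calc f n (\<lambda>i. r *\<^sub>R creation i))"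
  have "continuous_on UNIV (\<lambda>r. norm (poly_calc f n (\<lambda>i. r *\<^sub>R creation i)))" for n
    unfolding poly_calc_def word_op_scaleR scaleC_op_scaleR by (intro continuous_intros)
  then have "(\<lambda>r. norm (poly_calc f n (\<lambda>i. r *\<^sub>R creation i))) \<in> borel_measurable borel" for n
    by (rule borel_measurable_continuous_onI)
  then have meas: "?g n \<in> borel_measurable borel" for n
    by (intro borel_measurable_scaleR borel_measurable_indicator) auto
  have lim: "(\<lambda>n. ?g n r) \<longlonglongrightarrow> indicator {0..<1} r *\<^sub>R radial_norm f r" for r
    unfolding radial_norm_def
    by (cases "r \<in> {0..<1}") (auto intro!: tendsto_norm radial_LIMSEQ f)
  have "(\<lambda>r. indicator {0..<1} r *\<^sub>R radial_norm f r) \<in> borel_measurable borel"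
    by (rule borel_measurable_LIMSEQ_real[OF lim meas])
  \<comment> \<open>Convergence at \<open>r = 1\<close> is unknown, so that value is added back as a
    one-point function.\<close>
  then have "(\<lambda>r. indicator {0..<1} r *\<^sub>R radial_norm f r + indicator {1} r *\<^sub>R radial_norm f 1)
      \<in> borel_measurable borel"
    by simp
  moreover have "indicator {0..<1} r *\<^sub>R radial_norm f r + indicator {1} r *\<^sub>R radial_norm f 1
      = indicator {0..1} r *\<^sub>R radial_norm f r" for r :: real
    by (auto simp: indicator_def)
  ultimately show ?thesis
    unfolding set_borel_measurable_def by (simp add: measurable_completion)
qed

lemma radial_norm_diff_le:
  assumes "f \<in> Hol" "g \<in> Hol" "0 \<le> r" "r < 1"
  shows "radial_norm (g - f) r \<le> radial_norm g r + radial_norm f r"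
  unfolding radial_norm_def using assms
  by (subst func_calc_diff)
     (auto intro: norm_triangle_ineq4 scaleR_bounded_ops creation_bounded_ops row_norm_scaled_creation_less)

text \<open>The sum is at most twice the maximum. The lossy constant is harmless, as only
  integrability in \<open>Hp_diff\<close> is at stake.\<close>

lemma powr_add_le:
  fixes x y p :: real
  assumes "0 \<le> x" "0 \<le> y" "0 \<le> p"
  shows "(x + y) powr p \<le> 2 powr p * (x powr p + y powr p)"
proof -
  have "(x + y) powr p \<le> (2 * max x y) powr p"
    using assms by (intro powr_mono2) auto
  also have "\<dots> = 2 powr p * (max x y) powr p"
    using assms by (simp add: powr_mult)
  also have "\<dots> \<le> 2 powr p * (x powr p + y powr p)"
    by (intro mult_left_mono) (auto simp: max_def)
  finally show ?thesis .
qed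

text \<open>Continuity comes from the norm bound at \<open>g - f\<close>, which must therefore lie
  in the space.\<close>

lemma Hp_diff:
  assumes "f \<in> Hp p" "g \<in> Hp p" "0 \<le> p"
  shows "g - f \<in> Hp p"
proof -
  have Hol: "f \<in> Hol" "g \<in> Hol" "g - f \<in> Hol"
    using assms Hol_diff by (auto simp: Hp_def)
  let ?F = "\<lambda>h r. indicator {0..1} r *\<^sub>R radial_norm h r powr p"
  have "integrable lebesgue (?F f)" "integrable lebesgue (?F g)"
    using assms by (auto simp: Hp_def set_integrable_def)
  then have int: "integrable lebesgue (\<lambda>r. 2 powr p * (?F g r + ?F f r))"
    by (intro Bochner_Integration.integrable_mult_right Bochner_Integration.integrable_add)
  \<comment> \<open>The indicator is also put inside the power, because measurability is known for
    the cut-off radial norm.\<close>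
  have "(\<lambda>r. (indicator {0..1} r *\<^sub>R radial_norm (g - f) r) powr p) \<in> borel_measurable lebesgue"
    using radial_norm_measurable[OF Hol(3)] unfolding set_borel_measurable_def
    by (rule powr_real_measurable) simp
  then have "(\<lambda>r. indicator {0..1} r *\<^sub>R (indicator {0..1} r *\<^sub>R radial_norm (g - f) r) powr p)
      \<in> borel_measurable lebesgue"
    by (intro borel_measurable_scaleR borel_measurable_indicator) auto
  moreover have "indicator {0..1} r *\<^sub>R (indicator {0..1} r *\<^sub>R radial_norm (g - f) r) powr p = ?F (g - f) r" for r
    by (simp add: indicator_def)
  ultimately have meas: "?F (g - f) \<in> borel_measurable lebesgue"
    by (simp only:)
  have "integrable lebesgue (?F (g - f))"
  proof (rule Bochner_Integration.integrable_bound[OF int meas])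
    \<comment> \<open>At \<open>r = 1\<close> the series may diverge and \<open>func_calc\<close> be
      a default value, so the triangle inequality is used only off this null set.\<close>
    have "AE r in lebesgue. r \<noteq> (1::real)"
      by (rule AE_I'[of "{1}"]) auto
    then show "AE r in lebesgue. norm (?F (g - f) r) \<le> norm (2 powr p * (?F g r + ?F f r))"
    proof eventually_elim
      case (elim r)
      show ?case
      proof (cases "r \<in> {0..1}")
        case True
        then have "radial_norm (g - f) r powr p \<le> (radial_norm g r + radial_norm f r) powr p"
          using elim Hol assms(3) by (intro powr_mono2 radial_norm_diff_le) (auto simp: radial_norm_nonneg)
        also have "\<dots> \<le> 2 powr p * (radial_norm g r powr p + radial_norm f r powr p)"
          using assms(3) by (intro powr_add_le) (auto simp: radial_norm_nonneg)
        finally show ?thesis using True by (simp add: abs_mult)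
      qed simp
    qed
  qed
  then show ?thesis
    using Hol radial_norm_measurable by (auto simp: Hp_def set_integrable_def)
qed

lemma norm_func_calc_le:
  fixes T :: "'n::finite \<Rightarrow> 'h::chilbert_space \<Rightarrow>\<^sub>L 'h"
  assumes T: "T \<in> open_row_ball" and p: "p > 0" and f: "f \<in> Hp p"
  shows "norm (func_calc f T) \<le> 1 / (1 - row_norm T) powr (1 / p) * Hp_norm p f"
proof -
  define c where "c = norm (func_calc f T)"
  define t where "t = row_norm T"
  define I where "I = (LINT r:{0..1}|lebesgue. radial_norm f r powr p)"
  have t: "0 \<le> t" "t < 1" and TB: "\<And>i. T i \<in> bounded_ops"
    using T by (auto simp: open_row_ball_def t_def row_norm_nonneg)
  have fH: "f \<in> Hol" using f by (simp add: Hp_def)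
  \<comment> \<open>The interval has length \<open>1 - t\<close>; being open, it keeps
    \<open>r\<close> strictly between \<open>row_norm T\<close> and \<open>1\<close>, as
    \<open>von_neumann_radial\<close> demands.\<close>
  have "(1 - t) * c powr p = (LINT r:{t<..<1}|lebesgue. c powr p)"
    using t by (simp add: set_lebesgue_integral_def)
  also have "\<dots> \<le> I"
    unfolding I_def set_lebesgue_integral_def
  proof (rule integral_mono)
    show "integrable lebesgue (\<lambda>r. indicator {t<..<1} r *\<^sub>R c powr p)"
      using t by simp
    show "integrable lebesgue (\<lambda>r. indicator {0..1} r *\<^sub>R radial_norm f r powr p)"
      using f by (simp add: Hp_def set_integrable_def)
    fix r :: real
    show "indicator {t<..<1} r *\<^sub>R c powr p \<le> indicator {0..1} r *\<^sub>R radial_norm f r powr p"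
    proof (cases "r \<in> {t<..<1}")
      case True
      then have "c \<le> radial_norm f r"
        unfolding c_def t_def by (intro von_neumann_radial TB fH) auto
      then have "c powr p \<le> radial_norm f r powr p"
        using p by (intro powr_mono2) (auto simp: c_def)
      then show ?thesis using True t by simp
    qed simp
  qed
  finally have "c powr p \<le> I / (1 - t)"
    using t by (simp add: field_simps)
  then have "(c powr p) powr (1 / p) \<le> (I / (1 - t)) powr (1 / p)"
    using p by (intro powr_mono2) auto
  moreover have "(c powr p) powr (1 / p) = c"
    using p by (simp add: powr_powr c_def)
  moreover have "(I / (1 - t)) powr (1 / p) = 1 / (1 - t) powr (1 / p) * I powr (1 / p)"
    using t by (simp add: powr_divide)
  ultimately show ?thesis
    by (simp add: c_def t_def Hp_norm_def I_def)
qed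

text \<open>\<open>Hp p\<close> is a set of coefficient families, so continuity for
  \<open>Hp_norm\<close> is spelled out with \<open>\<epsilon>\<close> and
  \<open>\<delta>\<close>.\<close>

theorem theorem7p3:
  fixes T :: "'n::finite \<Rightarrow> 'h::chilbert_space \<Rightarrow>\<^sub>L 'h" and p :: real
  assumes "T \<in> open_row_ball" and "p \<ge> 1"
  shows "(\<lambda>f. func_calc f T) \<in> Hp p \<rightarrow> bounded_ops
    \<and> (\<forall>f\<in>Hp p. \<forall>\<epsilon>>0. \<exists>\<delta>>0. \<forall>g\<in>Hp p.
          Hp_norm p (g - f) < \<delta> \<longrightarrow> norm (func_calc g T - func_calc f T) < \<epsilon>)
    \<and> (\<forall>f\<in>Hp p. norm (func_calc f T) \<le> 1 / (1 - row_norm T) powr (1 / p) * Hp_norm p f)"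
proof (intro conjI ballI allI impI)
  have TB: "\<And>i. T i \<in> bounded_ops" and lt: "row_norm T < 1"
    using assms(1) by (auto simp: open_row_ball_def)
  have Hol: "f \<in> Hol" if "f \<in> Hp p" for f :: "'n nc_series"
    using that by (simp add: Hp_def)
  show "(\<lambda>f. func_calc f T) \<in> Hp p \<rightarrow> bounded_ops"
    using Hol by (auto intro!: func_calc_bounded_ops TB lt)
  show bound: "norm (func_calc f T) \<le> 1 / (1 - row_norm T) powr (1 / p) * Hp_norm p f"
    if "f \<in> Hp p" for f
    using assms that by (intro norm_func_calc_le) auto
  fix f :: "'n nc_series" and \<epsilon> :: real
  assume f: "f \<in> Hp p" and \<epsilon>: "\<epsilon> > 0"
  \<comment> \<open>The reciprocal of the constant in the bound;
    \<open>\<delta> = \<epsilon> * K\<close> then works uniformly in \<open>f\<close>.\<close>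
  define K where "K = (1 - row_norm T) powr (1 / p)"
  have K: "K > 0" using lt by (simp add: K_def)
  have "norm (func_calc g T - func_calc f T) < \<epsilon>" if "g \<in> Hp p" "Hp_norm p (g - f) < \<epsilon> * K" for g
  proof -
    have "norm (func_calc g T - func_calc f T) = norm (func_calc (g - f) T)"
      using f that(1) by (simp add: func_calc_diff TB lt Hol)
    also have "\<dots> \<le> 1 / K * Hp_norm p (g - f)"
      unfolding K_def using assms(2) f that(1) by (intro bound Hp_diff) auto
    also have "\<dots> < \<epsilon>" using that(2) K by (simp add: field_simps)
    finally show ?thesis .
  qed
  then show "\<exists>\<delta>>0. \<forall>g\<in>Hp p. Hp_norm p (g - f) < \<delta> \<longrightarrow> norm (func_calc g T - func_calc f T) < \<epsilon>"
    using K \<epsilon> by (intro exI[of _ "\<epsilon> * K"]) auto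
qed

end
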